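(* (i) For all $\phi,\psi\in S$ one has $2\tilde L_2(\phi,\psi)=(-1)^{\frac12n(n-1)}\psi^*\circ\phi-\phi^*\circ\psi$, in the sense that for all $v\in V$, $$2[\tilde L_2(\phi,\psi),v]=(-1)^{\frac12n(n-1)}\psi^*\circ\phi(v)-\phi^*\circ\psi(v),$$ where $[\ ,\ ]$ is the commutator in $C(V,g)$. (ii) For all $\phi,\psi\in S$ and all $v\in V$, $$2B(\phi,\psi)v=(-1)^{\frac12n(n-1)}\psi^*\circ\phi(v)+\phi^*\circ\psi(v).$$
   Context: $k$ is a field of characteristic not $2$ or $3$; $V$ is a $2n$-dimensional $k$-vector space with a nondegenerate symmetric bilinear form $g$ of Witt index $n$ (hyperbolic). $C=C(V,g)$ is the Clifford algebra, $vw+wv=2g(v,w)1$ for $v,w\in V\subset C$. $S$ is a fixed $2^n$-dimensional $k$-vector space (spinors) with an algebra isomorphism $C\cong End(S)$; $c\cdot\psi$ denotes the action of $c\in C$ on $\psi\in S$. A spinor norm is a bilinear map $B:S\times S\to k$ with $B(v\cdot\phi,\psi)=B(\phi,v\cdot\psi)$ for all $v\in V$, $\phi,\psi\in S$; a nondegenerate spinor norm $B$ is fixed. (It is known that $B(\psi,\phi)=(-1)^{\frac12n(n-1)}B(\phi,\psi)$.) An orthonormal basis of $V$ is a basis $x_1,\dots,x_{2n}$ with $g(x_i,x_j)=\pm\delta_{ij}$. $C^2\subset C$ is the span of the products $x_ix_j$, $i<j$. The map $\tilde L_2:S\times S\to C^2$ is $\tilde L_2(\phi,\psi)=\frac12\sum_{i<j}g(x_i,x_i)g(x_j,x_j)B(\phi,x_jx_i\cdot\psi)\,x_ix_j$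 for any orthonormal basis (independent of the choice). Each $\phi\in S$ defines linear maps $\phi:V\to S$, $\phi(v)=v\cdot\phi$, and $\phi^*:S\to V$, $\phi^*(\psi)=\sum_ig(x_i,x_i)B(\phi,x_i\cdot\psi)\,x_i$, for any orthonormal basis. *)

theory Defs
  imports "HOL-Algebra.Algebra" "HOL-Algebra.Algebraic_Closure_Type" "HOL-Library.Poly_Mapping"
begin

section \<open>Vector spaces and bilinear forms\<close>

definition has_dimension :: "('k::field \<Rightarrow> 'a::ab_group_add \<Rightarrow> 'a) \<Rightarrow> nat \<Rightarrow> bool" where
  "has_dimension s d \<longleftrightarrow> (\<exists>b. finite_dimensional_vector_space s b \<and> card b = d)"

definition bilinear_form ::
    "('k::field \<Rightarrow> 'a::ab_group_add \<Rightarrow> 'a) \<Rightarrow> ('a \<Rightarrow> 'a \<Rightarrow> 'k) \<Rightarrow> bool" where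
  "bilinear_form s b \<longleftrightarrow>
     (\<forall>u. Vector_Spaces.linear s (*) (\<lambda>w. b u w)) \<and>
     (\<forall>w. Vector_Spaces.linear s (*) (\<lambda>u. b u w))"

definition nondegenerate :: "('a::zero \<Rightarrow> 'a \<Rightarrow> 'k::zero) \<Rightarrow> bool" where
  "nondegenerate b \<longleftrightarrow>
     (\<forall>u. (\<forall>w. b u w = 0) \<longrightarrow> u = 0) \<and> (\<forall>w. (\<forall>u. b u w = 0) \<longrightarrow> w = 0)"

definition symmetric_form :: "('a \<Rightarrow> 'a \<Rightarrow> 'k) \<Rightarrow> bool" where
  "symmetric_form b \<longleftrightarrow> (\<forall>u w. b u w = b w u)"

definition totally_isotropic :: "('a \<Rightarrow> 'a \<Rightarrow> 'k::zero) \<Rightarrow> 'a set \<Rightarrow> bool" where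
  "totally_isotropic b W \<longleftrightarrow> (\<forall>u\<in>W. \<forall>w\<in>W. b u w = 0)"

definition witt_index ::
    "('k::field \<Rightarrow> 'a::ab_group_add \<Rightarrow> 'a) \<Rightarrow> ('a \<Rightarrow> 'a \<Rightarrow> 'k) \<Rightarrow> nat" where
  "witt_index s b =
     Max {vector_space.dim s W | W. module.subspace s W \<and> totally_isotropic b W}"

text \<open>Bases are families indexed by \<open>1, \<dots>, d\<close>; the values of \<open>x\<close> at other indices are irrelevant.\<close>

definition orthonormal_basis ::
    "('k::field \<Rightarrow> 'a::ab_group_add \<Rightarrow> 'a) \<Rightarrow> ('a \<Rightarrow> 'a \<Rightarrow> 'k) \<Rightarrow> nat \<Rightarrow> (nat \<Rightarrow> 'a) \<Rightarrow> bool" where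
  "orthonormal_basis s b d x \<longleftrightarrow>
     inj_on x {1..d} \<and> \<not> module.dependent s (x ` {1..d}) \<and> module.span s (x ` {1..d}) = UNIV \<and>
     (\<forall>i\<in>{1..d}. \<forall>j\<in>{1..d}. if i = j then b (x i) (x j) = 1 \<or> b (x i) (x j) = - 1
                             else b (x i) (x j) = 0)"


section \<open>The Clifford algebra\<close>

text \<open>
  Finitely supported functions from words in \<open>'v\<close> to \<open>'k\<close>, with convolution product, form the free
  associative unital \<open>'k\<close>-algebra on the set \<open>'v\<close>. Its quotient by the relations making the
  inclusion of generators linear is the tensor algebra \<open>T(V)\<close>, and imposing
  \<open>v w + w v = 2 g(v,w) 1\<close> as well yields \<open>C(V,g)\<close>. Both kinds of relations are imposed at once.
\<close>

datatype 'v word = Word (letters: "'v list")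

instantiation word :: (type) monoid_add
begin
definition zero_word :: "'v word" where "zero_word = Word []"
definition plus_word :: "'v word \<Rightarrow> 'v word \<Rightarrow> 'v word" where
  "plus_word u w = Word (letters u @ letters w)"
instance by standard (simp_all add: zero_word_def plus_word_def)
end

type_synonym ('v, 'k) free_alg = "'v word \<Rightarrow>\<^sub>0 'k"

definition free_gen :: "'v \<Rightarrow> ('v, 'k::field) free_alg" where
  "free_gen v = Poly_Mapping.single (Word [v]) 1"

definition free_const :: "'k::field \<Rightarrow> ('v, 'k) free_alg" where
  "free_const a = Poly_Mapping.single 0 a"

definition clifford_relations ::
    "('k::field \<Rightarrow> 'v::ab_group_add \<Rightarrow> 'v) \<Rightarrow> ('v \<Rightarrow> 'v \<Rightarrow> 'k) \<Rightarrow> ('v, 'k) free_alg set" where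
  "clifford_relations s g =
     {free_gen (v + w) - free_gen v - free_gen w | v w. True} \<union>
     {free_gen (s a v) - free_const a * free_gen v | a v. True} \<union>
     {free_gen v * free_gen w + free_gen w * free_gen v - free_const (2 * g v w) | v w. True}"

definition clifford_ideal ::
    "('k::field \<Rightarrow> 'v::ab_group_add \<Rightarrow> 'v) \<Rightarrow> ('v \<Rightarrow> 'v \<Rightarrow> 'k) \<Rightarrow> ('v, 'k) free_alg set" where
  "clifford_ideal s g = Idl\<^bsub>ring_of_type_algebra\<^esub> (clifford_relations s g)"

definition clifford_algebra ::
    "('k::field \<Rightarrow> 'v::ab_group_add \<Rightarrow> 'v) \<Rightarrow> ('v \<Rightarrow> 'v \<Rightarrow> 'k) \<Rightarrow> ('v, 'k) free_alg set ring" where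
  "clifford_algebra s g = ring_of_type_algebra Quot clifford_ideal s g"

definition clifford_class ::
    "('k::field \<Rightarrow> 'v::ab_group_add \<Rightarrow> 'v) \<Rightarrow> ('v \<Rightarrow> 'v \<Rightarrow> 'k) \<Rightarrow>
     ('v, 'k) free_alg \<Rightarrow> ('v, 'k) free_alg set" where
  "clifford_class s g t = clifford_ideal s g +>\<^bsub>ring_of_type_algebra\<^esub> t"

text \<open>The canonical map \<open>V \<rightarrow> C(V,g)\<close>, by which \<open>V\<close> is regarded as a subspace of \<open>C(V,g)\<close>.\<close>

definition clifford_vec ::
    "('k::field \<Rightarrow> 'v::ab_group_add \<Rightarrow> 'v) \<Rightarrow> ('v \<Rightarrow> 'v \<Rightarrow> 'k) \<Rightarrow> 'v \<Rightarrow> ('v, 'k) free_alg set" where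
  "clifford_vec s g v = clifford_class s g (free_gen v)"

definition clifford_scale ::
    "('k::field \<Rightarrow> 'v::ab_group_add \<Rightarrow> 'v) \<Rightarrow> ('v \<Rightarrow> 'v \<Rightarrow> 'k) \<Rightarrow>
     'k \<Rightarrow> ('v, 'k) free_alg set \<Rightarrow> ('v, 'k) free_alg set" where
  "clifford_scale s g a c = clifford_class s g (free_const a) \<otimes>\<^bsub>clifford_algebra s g\<^esub> c"

definition commutator :: "('c, 'm) ring_scheme \<Rightarrow> 'c \<Rightarrow> 'c \<Rightarrow> 'c" where
  "commutator R a b = (a \<otimes>\<^bsub>R\<^esub> b) \<ominus>\<^bsub>R\<^esub> (b \<otimes>\<^bsub>R\<^esub> a)"


section \<open>Spinors\<close>

definition End_ring :: "('k::field \<Rightarrow> 's::ab_group_add \<Rightarrow> 's) \<Rightarrow> ('s \<Rightarrow> 's) ring" where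
  "End_ring s =
     \<lparr>carrier = {f. Vector_Spaces.linear s s f}, monoid.mult = (\<circ>), one = id,
      ring.zero = (\<lambda>_. 0), add = (\<lambda>f h x. f x + h x)\<rparr>"

text \<open>\<open>\<rho> : C(V,g) \<rightarrow> End(S)\<close> is an isomorphism of \<open>k\<close>-algebras. The Clifford action
  \<open>c \<cdot> \<psi>\<close> is \<open>\<rho> c \<psi>\<close>.\<close>

definition clifford_End_iso ::
    "('k::field \<Rightarrow> 'v::ab_group_add \<Rightarrow> 'v) \<Rightarrow> ('v \<Rightarrow> 'v \<Rightarrow> 'k) \<Rightarrow>
     ('k \<Rightarrow> 's::ab_group_add \<Rightarrow> 's) \<Rightarrow> (('v, 'k) free_alg set \<Rightarrow> 's \<Rightarrow> 's) \<Rightarrow> bool" where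
  "clifford_End_iso sV g sS \<rho> \<longleftrightarrow>
     \<rho> \<in> ring_iso (clifford_algebra sV g) (End_ring sS) \<and>
     (\<forall>a. \<forall>c\<in>carrier (clifford_algebra sV g). \<rho> (clifford_scale sV g a c) = (\<lambda>\<psi>. sS a (\<rho> c \<psi>)))"

definition spinor_norm ::
    "('k::field \<Rightarrow> 'v::ab_group_add \<Rightarrow> 'v) \<Rightarrow> ('v \<Rightarrow> 'v \<Rightarrow> 'k) \<Rightarrow>
     ('k \<Rightarrow> 's::ab_group_add \<Rightarrow> 's) \<Rightarrow> (('v, 'k) free_alg set \<Rightarrow> 's \<Rightarrow> 's) \<Rightarrow>
     ('s \<Rightarrow> 's \<Rightarrow> 'k) \<Rightarrow> bool" where
  "spinor_norm sV g sS \<rho> B \<longleftrightarrow>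
     bilinear_form sS B \<and>
     (\<forall>v \<phi> \<psi>. B (\<rho> (clifford_vec sV g v) \<phi>) \<psi> = B \<phi> (\<rho> (clifford_vec sV g v) \<psi>))"

text \<open>The map \<open>\<phi> : V \<rightarrow> S\<close>, \<open>\<phi>(v) = v \<cdot> \<phi>\<close>, attached to a spinor \<open>\<phi>\<close>.\<close>

definition spinor_map ::
    "('k::field \<Rightarrow> 'v::ab_group_add \<Rightarrow> 'v) \<Rightarrow> ('v \<Rightarrow> 'v \<Rightarrow> 'k) \<Rightarrow>
     (('v, 'k) free_alg set \<Rightarrow> 's \<Rightarrow> 's) \<Rightarrow> 's \<Rightarrow> 'v \<Rightarrow> 's" where
  "spinor_map sV g \<rho> \<phi> v = \<rho> (clifford_vec sV g v) \<phi>"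

text \<open>
  The maps \<open>\<phi>\<^sup>* : S \<rightarrow> V\<close> and \<open>tilde_L2 : S \<times> S \<rightarrow> C(V,g)\<close> are given by formulas in an orthonormal basis which
  do not depend on that basis. Hence the formulas are stated relative to a basis \<open>x\<close>, and the maps
  are defined by the common value of the formula over all orthonormal bases of the
  \<open>2n\<close>-dimensional space \<open>V\<close>.
\<close>

definition spinor_dual_wrt ::
    "('k::field \<Rightarrow> 'v::ab_group_add \<Rightarrow> 'v) \<Rightarrow> ('v \<Rightarrow> 'v \<Rightarrow> 'k) \<Rightarrow>
     (('v, 'k) free_alg set \<Rightarrow> 's \<Rightarrow> 's) \<Rightarrow> ('s \<Rightarrow> 's \<Rightarrow> 'k) \<Rightarrow> nat \<Rightarrow>
     (nat \<Rightarrow> 'v) \<Rightarrow> 's \<Rightarrow> 's \<Rightarrow> 'v" where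
  "spinor_dual_wrt sV g \<rho> B n x \<phi> \<psi> =
     (\<Sum>i=1..2*n. sV (g (x i) (x i) * B \<phi> (\<rho> (clifford_vec sV g (x i)) \<psi>)) (x i))"

definition spinor_dual ::
    "('k::field \<Rightarrow> 'v::ab_group_add \<Rightarrow> 'v) \<Rightarrow> ('v \<Rightarrow> 'v \<Rightarrow> 'k) \<Rightarrow>
     (('v, 'k) free_alg set \<Rightarrow> 's \<Rightarrow> 's) \<Rightarrow> ('s \<Rightarrow> 's \<Rightarrow> 'k) \<Rightarrow> nat \<Rightarrow> 's \<Rightarrow> 's \<Rightarrow> 'v" where
  "spinor_dual sV g \<rho> B n \<phi> \<psi> =
     (THE w. \<forall>x. orthonormal_basis sV g (2*n) x \<longrightarrow> w = spinor_dual_wrt sV g \<rho> B n x \<phi> \<psi>)"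

definition tilde_L2_wrt ::
    "('k::field \<Rightarrow> 'v::ab_group_add \<Rightarrow> 'v) \<Rightarrow> ('v \<Rightarrow> 'v \<Rightarrow> 'k) \<Rightarrow>
     (('v, 'k) free_alg set \<Rightarrow> 's \<Rightarrow> 's) \<Rightarrow> ('s \<Rightarrow> 's \<Rightarrow> 'k) \<Rightarrow> nat \<Rightarrow>
     (nat \<Rightarrow> 'v) \<Rightarrow> 's \<Rightarrow> 's \<Rightarrow> ('v, 'k) free_alg set" where
  "tilde_L2_wrt sV g \<rho> B n x \<phi> \<psi> =
     (let C = clifford_algebra sV g; e = (\<lambda>i. clifford_vec sV g (x i)) in
      clifford_scale sV g (1 / 2)
        (\<Oplus>\<^bsub>C\<^esub>p\<in>{(i, j). 1 \<le> i \<and> i < j \<and> j \<le> 2*n}. case p of (i, j) \<Rightarrow>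
          clifford_scale sV g
            (g (x i) (x i) * g (x j) (x j) * B \<phi> (\<rho> (e j \<otimes>\<^bsub>C\<^esub> e i) \<psi>))
            (e i \<otimes>\<^bsub>C\<^esub> e j)))"

definition tilde_L2 ::
    "('k::field \<Rightarrow> 'v::ab_group_add \<Rightarrow> 'v) \<Rightarrow> ('v \<Rightarrow> 'v \<Rightarrow> 'k) \<Rightarrow>
     (('v, 'k) free_alg set \<Rightarrow> 's \<Rightarrow> 's) \<Rightarrow> ('s \<Rightarrow> 's \<Rightarrow> 'k) \<Rightarrow> nat \<Rightarrow> 's \<Rightarrow> 's \<Rightarrow>
     ('v, 'k) free_alg set" where
  "tilde_L2 sV g \<rho> B n \<phi> \<psi> =
     (THE c. \<forall>x. orthonormal_basis sV g (2*n) x \<longrightarrow> c = tilde_L2_wrt sV g \<rho> B n x \<phi> \<psi>)"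

end

theory Submission
  imports Defs
begin

text \<open>
  Everything is computed in the spinor module, where \<open>v \<cdot> w \<cdot> \<chi> + w \<cdot> v \<cdot> \<chi> = 2 g(v,w) \<chi>\<close>; the Clifford
  algebra acts faithfully on it, so an identity of operators is an identity in the algebra.

  \<^bold>\<open>Symmetry of the spinor norm.\<close> Both formulas contain the sign \<open>\<epsilon> = (-1)\<^bsup>n(n-1)/2\<^esup>\<close> only
  because \<open>B(\<psi>,\<phi>) = \<epsilon> B(\<phi>,\<psi>)\<close>, which is proved here (\<open>B_symmetry\<close>). As the Witt index is \<open>n\<close>, there are
  hyperbolic pairs \<open>w\<^sub>i, w'\<^sub>i\<close>. Call a spinor a vacuum if all \<open>w\<^sub>i\<close> kill it. Each pair halves the
  dimension, so a submodule \<open>R\<close> satisfies \<open>dim R = 2\<^sup>n dim(vacua in R)\<close> (\<open>dim_stable\<close>). As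
  \<open>dim S = 2\<^sup>n\<close>, the vacua form a line \<open>k u\<close>, and a submodule containing \<open>u\<close> is all of \<open>S\<close>.
  The product \<open>\<nu>\<close> of the \<open>w\<^sub>i\<close> is a nonzero operator with values in \<open>k u\<close>, and its transpose under \<open>B\<close>
  is the reversed product, which is \<open>\<epsilon> \<nu>\<close> because the \<open>w\<^sub>i\<close> anticommute. Comparing
  \<open>B(\<nu>\<phi>,\<psi>) = \<epsilon> B(\<phi>,\<nu>\<psi>)\<close> for suitable spinors gives the symmetry when one argument is \<open>u\<close>; the
  spinors for which it holds form a submodule, hence it holds everywhere.

  \<^bold>\<open>The two formulas.\<close> The vector \<open>\<phi>\<^sup>*(\<psi>)\<close> is the one with \<open>g(\<phi>\<^sup>*(\<psi>),v) = B(\<phi>, v \<cdot> \<psi>)\<close>. Pairing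
  \<open>\<epsilon> \<psi>\<^sup>*(v \<cdot> \<phi>) + \<phi>\<^sup>*(v \<cdot> \<psi>)\<close> with a vector \<open>y\<close> gives \<open>B(\<phi>, (v y + y v) \<cdot> \<psi>)\<close> by the symmetry of \<open>B\<close>, and
  this is \<open>2 g(v,y) B(\<phi>,\<psi>)\<close> by the Clifford relation. For the commutator formula, the sum over \<open>i < j\<close> defining the bivector is, up to a
  multiple of the identity, half of the sum over all \<open>i, j\<close>
  (\<open>bivector_full_sum\<close>). The full sum is a contraction with the inverse of \<open>g\<close>, which explains why the basis
  does not matter, and its commutator with \<open>v\<close> follows from
  \<open>[x\<^sub>i x\<^sub>j, v] = 2 g(x\<^sub>j,v) x\<^sub>i - 2 g(x\<^sub>i,v) x\<^sub>j\<close>: contracting one index with \<open>v\<close> turns each of the two terms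
  into one of the vectors \<open>\<epsilon> \<psi>\<^sup>*(v \<cdot> \<phi>)\<close> and \<open>\<phi>\<^sup>*(v \<cdot> \<psi>)\<close>.
\<close>

section \<open>Nondegenerate symmetric bilinear forms\<close>

locale nondegenerate_symmetric_space = finite_dimensional_vector_space scale Basis
  for scale :: "'k::field \<Rightarrow> 'v::ab_group_add \<Rightarrow> 'v" (infixr "*v" 75) and Basis :: "'v set" +
  fixes g :: "'v \<Rightarrow> 'v \<Rightarrow> 'k"
  assumes bilinear_g: "bilinear_form scale g"
    and symmetric_g: "symmetric_form g"
    and nondegenerate_g: "nondegenerate g"
    and two_nonzero: "(2::'k) \<noteq> 0"
begin

lemma linear_g: "Vector_Spaces.linear scale (*) (g u)"
  using bilinear_g by (simp add: bilinear_form_def)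

lemma g_commute: "g u w = g w u"
  using symmetric_g by (simp add: symmetric_form_def)

lemma g_add_right: "g u (v + w) = g u v + g u w"
  and g_scale_right: "g u (a *v w) = a * g u w"
  and g_diff_right: "g u (v - w) = g u v - g u w"
  and g_sum_right: "g u (\<Sum>i\<in>I. f i) = (\<Sum>i\<in>I. g u (f i))"
  and g_zero_right: "g u 0 = 0"
proof -
  interpret l: Vector_Spaces.linear scale "(*)" "g u" by (rule linear_g)
  show "g u (v + w) = g u v + g u w" "g u (a *v w) = a * g u w"
    "g u (v - w) = g u v - g u w" "g u (\<Sum>i\<in>I. f i) = (\<Sum>i\<in>I. g u (f i))" "g u 0 = 0"
    by (simp_all add: l.add l.scale l.diff l.sum l.zero)
qed

lemma g_add_left: "g (v + w) u = g v u + g w u"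
  and g_scale_left: "g (a *v w) u = a * g w u"
  and g_diff_left: "g (v - w) u = g v u - g w u"
  and g_sum_left: "g (\<Sum>i\<in>I. f i) u = (\<Sum>i\<in>I. g (f i) u)"
  and g_zero_left: "g 0 u = 0"
  by (simp_all only: g_commute[of _ u] g_add_right g_scale_right g_diff_right g_sum_right
      g_zero_right)

lemmas g_simps = g_add_right g_scale_right g_diff_right g_sum_right g_zero_right
  g_add_left g_scale_left g_diff_left g_sum_left g_zero_left

lemma eq_if_g_eq:
  assumes "\<And>w. g u w = g v w"
  shows "u = v"
proof -
  have "g (u - v) w = 0" for w
    using assms by (simp add: g_simps)
  then show ?thesis
    using nondegenerate_g unfolding nondegenerate_def by (metis eq_iff_diff_eq_0)
qed

lemma g_zero_on_spanning:
  assumes "span A = UNIV" "\<And>x. x \<in> A \<Longrightarrow> g u x = 0"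
  shows "u = 0"
proof (rule eq_if_g_eq)
  fix w
  have "w \<in> span A" using assms by simp
  then have "g u w = 0"
    by (induction w rule: span_induct_alt) (use assms in \<open>auto simp: g_simps\<close>)
  then show "g u w = g 0 w" by (simp add: g_simps)
qed

text \<open>The map \<open>v \<mapsto> \<Sum>e. g(e,v) e\<close> over a basis \<open>E\<close> extending \<open>A\<close> is injective by nondegeneracy,
  hence surjective; preimages of the basis vectors are the dual vectors.\<close>

lemma dual_vectors:
  assumes "independent A"
  shows "\<exists>d. \<forall>a\<in>A. \<forall>b\<in>A. g a (d b) = (if a = b then 1 else 0)"
proof -
  define E where "E = extend_basis A"
  have AE: "A \<subseteq> E" and indE: "independent E" and spanE: "span E = UNIV"
    unfolding E_def using assms
    by (auto simp: extend_basis_superset independent_extend_basis)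
  have finE: "finite E" using indE by (rule finiteI_independent)
  define L where "L v = (\<Sum>e\<in>E. g e v *v e)" for v
  have L: "Vector_Spaces.linear scale scale L"
    unfolding Vector_Spaces.linear_iff
    by (auto simp: L_def g_simps algebra_simps sum.distrib scale_sum_right vector_space_axioms)
  have coeff: "f e = f' e"
    if "(\<Sum>e\<in>E. f e *v e) = (\<Sum>e\<in>E. f' e *v e)" "e \<in> E" for f f' :: "'v \<Rightarrow> 'k" and e
  proof -
    have "(\<Sum>e\<in>E. (f e - f' e) *v e) = 0"
      using that(1) by (simp add: scale_left_diff_distrib sum_subtractf)
    from independentD[OF indE finE order_refl this that(2)] show ?thesis by simp
  qed
  have "inj L"
  proof (rule injI)
    fix u v assume "L u = L v"
    then have "g (u - v) e = 0" if "e \<in> E" for e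
      using coeff[OF _ that, of "\<lambda>e. g e u" "\<lambda>e. g e v"] unfolding L_def
      by (simp add: g_simps g_commute[of _ e])
    then have "u - v = 0" by (rule g_zero_on_spanning[OF spanE])
    then show "u = v" by simp
  qed
  then have "surj L" by (rule linear_inj_imp_surj[OF L])
  then obtain d where d: "\<And>b. L (d b) = b"
    by (metis surj_f_inv_f)
  have "g a (d b) = (if a = b then 1 else 0)" if "a \<in> A" "b \<in> A" for a b
  proof -
    have bE: "b \<in> E" using AE that by auto
    have "(\<Sum>e\<in>E. (if e = b then 1 else 0) *v e) = (\<Sum>e\<in>E. if b = e then e else 0)"
      by (rule sum.cong) auto
    also have "\<dots> = b"
      using finE bE by (simp add: sum.delta)
    finally have "(\<Sum>e\<in>E. g e (d b) *v e) = (\<Sum>e\<in>E. (if e = b then 1 else 0) *v e)"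
      using d[of b] unfolding L_def by simp
    then show ?thesis using coeff[of "\<lambda>e. g e (d b)" "\<lambda>e. if e = b then 1 else 0" a] AE that by auto
  qed
  then show ?thesis by blast
qed

text \<open>The factor 2 normalises the pairs so that \<open>w w' + w' w = 1\<close> in the Clifford algebra.\<close>

definition hyperbolic_pairs :: "nat \<Rightarrow> (nat \<Rightarrow> 'v) \<Rightarrow> (nat \<Rightarrow> 'v) \<Rightarrow> bool" where
  "hyperbolic_pairs m w w' \<longleftrightarrow>
     (\<forall>i<m. \<forall>j<m. g (w i) (w j) = 0 \<and> g (w' i) (w' j) = 0 \<and>
                  2 * g (w i) (w' j) = (if i = j then 1 else 0))"

text \<open>Dual vectors \<open>d\<^sub>j\<close> of a basis \<open>w\<^sub>i\<close> of a totally isotropic subspace can be made mutually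
  orthogonal and isotropic by subtracting \<open>\<Sum>\<^sub>i g(d\<^sub>j,d\<^sub>i)/2 w\<^sub>i\<close>, which leaves their pairing with the
  \<open>w\<^sub>i\<close> unchanged.\<close>

lemma hyperbolic_pairs_exist:
  assumes "subspace W" "totally_isotropic g W" "dim W = m"
  shows "\<exists>w w'. hyperbolic_pairs m w w'"
proof -
  obtain A where A: "A \<subseteq> W" "independent A" "card A = m"
    using basis_exists[of W] assms(3) by metis
  then have "finite A" by (auto intro: finiteI_independent)
  then obtain w where w: "bij_betw w {0..<m} A"
    using ex_bij_betw_nat_finite A(3) by blast
  obtain d where d: "\<And>a b. a \<in> A \<Longrightarrow> b \<in> A \<Longrightarrow> g a (d b) = (if a = b then 1 else 0)"
    using dual_vectors[OF A(2)] by metis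
  define q where "q i = d (w i)" for i
  have wA: "w i \<in> A" if "i < m" for i
    using w that by (auto simp: bij_betw_def)
  have gw: "g (w i) (w j) = 0" if "i < m" "j < m" for i j
    using that wA A(1) assms(2) unfolding totally_isotropic_def by blast
  have gq: "g (w i) (q j) = (if i = j then 1 else 0)" if "i < m" "j < m" for i j
    unfolding q_def using that wA d w by (simp add: bij_betw_def inj_on_def)
  define r where "r j = q j - (\<Sum>i<m. (g (q j) (q i) / 2) *v w i)" for j
  have gr: "g (w i) (r j) = (if i = j then 1 else 0)" if "i < m" "j < m" for i j
    unfolding r_def using that gq gw by (simp add: g_simps)
  have "g (r j) (r k) = 0" if "j < m" "k < m" for j k
  proof -
    have delta: "(\<Sum>i<m. a i * (if i = l then 1 else 0)) = a l"
      if "l < m" for a :: "nat \<Rightarrow> 'k" and l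
    proof -
      have "(\<Sum>i<m. a i * (if i = l then 1 else 0)) = (\<Sum>i<m. if i = l then a i else 0)"
        by (rule sum.cong) auto
      then show ?thesis using that by simp
    qed
    have "g (r j) (r k) = g (r j) (q k) - (\<Sum>i<m. g (q k) (q i) / 2 * g (w i) (r j))"
      unfolding r_def[of k] by (simp add: g_simps g_commute[of "r j" "w _"])
    also have "(\<Sum>i<m. g (q k) (q i) / 2 * g (w i) (r j)) = g (q k) (q j) / 2"
      using delta[OF that(1), of "\<lambda>i. g (q k) (q i) / 2"] that gr by simp
    also have "g (r j) (q k) = g (q j) (q k) - (\<Sum>i<m. g (q j) (q i) / 2 * g (w i) (q k))"
      unfolding r_def by (simp add: g_simps)
    also have "(\<Sum>i<m. g (q j) (q i) / 2 * g (w i) (q k)) = g (q j) (q k) / 2"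
      using delta[OF that(2), of "\<lambda>i. g (q j) (q i) / 2"] that gq by simp
    finally show ?thesis
      using two_nonzero by (simp add: g_commute[of "q k"] field_simps)
  qed
  then have "hyperbolic_pairs m w (\<lambda>j. (1 / 2) *v r j)"
    unfolding hyperbolic_pairs_def using gw gr two_nonzero by (simp add: g_simps)
  then show ?thesis by blast
qed

text \<open>The set of dimensions in the definition of the Witt index is bounded by the dimension of the
  space, so its maximum is attained.\<close>

lemma witt_index_attained:
  "\<exists>W. subspace W \<and> totally_isotropic g W \<and> dim W = witt_index scale g"
proof -
  let ?D = "{dim W | W. subspace W \<and> totally_isotropic g W}"
  have "?D \<subseteq> {..dimension}" using dim_subset_UNIV by auto
  then have "finite ?D" by (rule finite_subset) simp
  moreover have "dim {0} \<in> ?D"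
    by (auto intro!: exI[of _ "{0}"] simp: totally_isotropic_def g_simps)
  ultimately have "Max ?D \<in> ?D" by (intro Max_in) auto
  then show ?thesis unfolding witt_index_def by auto
qed

text \<open>A hyperbolic pair \<open>w, w'\<close> with \<open>2 g(w,w') = 1\<close> spans the plane with orthonormal basis
  \<open>w + w'\<close>, \<open>w - w'\<close>.\<close>

lemma orthonormal_basis_exists:
  assumes h: "hyperbolic_pairs n w w'" and dim: "card Basis = 2 * n"
  shows "\<exists>x. orthonormal_basis scale g (2 * n) x"
proof -
  \<comment> \<open>Basis indices start at 1, those of the pairs at 0: the sums come first, then the differences.\<close>
  define x where "x i = (if i \<le> n then w (i - 1) + w' (i - 1) else w (i - n - 1) - w' (i - n - 1))" for i
  have gww: "g (w i) (w j) = 0" "g (w' i) (w' j) = 0" if "i < n" "j < n" for i j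
    using h that unfolding hyperbolic_pairs_def by auto
  have gww'1: "g (w i) (w' j) = (if i = j then 1 / 2 else 0)" if "i < n" "j < n" for i j
  proof -
    have "2 * g (w i) (w' j) = (if i = j then 1 else 0)"
      using h that unfolding hyperbolic_pairs_def by blast
    then show ?thesis using two_nonzero by (auto simp: field_simps split: if_splits)
  qed
  note gww' = gww'1 gww'1[unfolded g_commute[of "w _" "w' _"]]
  have half: "1 / 2 + 1 / 2 = (1::'k)" "- (1 / 2) - 1 / 2 = - (1::'k)"
    using two_nonzero by (simp_all add: field_simps)
  have gx: "g (x i) (x j) = (if i = j then if i \<le> n then 1 else - 1 else 0)"
    if "i \<in> {1..2 * n}" "j \<in> {1..2 * n}" for i j
    using that by (auto simp: x_def g_simps gww gww' half)
  then have gxx: "g (x i) (x i) \<noteq> 0" if "i \<in> {1..2 * n}" for i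
    using that by simp
  have inj: "inj_on x {1..2 * n}"
    by (rule inj_onI) (metis gx gxx)
  have ind: "independent (x ` {1..2 * n})"
    unfolding dependent_finite[OF finite_imageI[OF finite_atLeastAtMost]]
  proof safe
    fix u k assume 0: "(\<Sum>v\<in>x ` {1..2 * n}. u v *v v) = 0" and k: "k \<in> {1..2 * n}" "u (x k) \<noteq> 0"
    have "(\<Sum>i\<in>{1..2 * n}. u (x i) *v x i) = 0"
      using 0 by (simp only: sum.reindex[OF inj] o_def)
    then have "0 = g (\<Sum>i\<in>{1..2 * n}. u (x i) *v x i) (x k)"
      by (simp only: g_simps)
    also have "\<dots> = (\<Sum>i\<in>{1..2 * n}. if i = k then u (x k) * g (x k) (x k) else 0)"
      unfolding g_simps by (rule sum.cong) (use gx k in auto)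
    also have "\<dots> = u (x k) * g (x k) (x k)" using k by (simp add: sum.delta)
    finally show False using k gxx by simp
  qed
  have "span (x ` {1..2 * n}) = UNIV"
    using card_eq_dim[of "x ` {1..2 * n}" UNIV] ind card_image[OF inj] dim by (auto simp: dim_UNIV)
  with inj ind gx have "orthonormal_basis scale g (2 * n) x"
    unfolding orthonormal_basis_def by simp
  then show ?thesis by blast
qed

lemma orthonormal_basis_square:
  assumes "orthonormal_basis scale g d x" "i \<in> {1..d}"
  shows "g (x i) (x i) * g (x i) (x i) = 1"
  using assms unfolding orthonormal_basis_def by fastforce

text \<open>The difference of the two sides is orthogonal to every \<open>x\<^sub>j\<close>. The signs
  \<open>g(x\<^sub>i,x\<^sub>i)\<close> take the place of their inverses.\<close>

lemma orthonormal_basis_expansion: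
  assumes x: "orthonormal_basis scale g d x"
  shows "v = (\<Sum>i=1..d. (g (x i) (x i) * g (x i) v) *v x i)"
proof -
  have "g (v - (\<Sum>i=1..d. (g (x i) (x i) * g (x i) v) *v x i)) y = 0" if "y \<in> x ` {1..d}" for y
  proof -
    obtain j where j: "j \<in> {1..d}" "y = x j" using \<open>y \<in> x ` {1..d}\<close> by auto
    have "(\<Sum>i=1..d. (g (x i) (x i) * g (x i) v) * g (x i) (x j))
        = (\<Sum>i=1..d. if i = j then g (x i) (x i) * g (x i) (x i) * g (x j) v else 0)"
      by (rule sum.cong) (use x j in \<open>auto simp: orthonormal_basis_def\<close>)
    also have "\<dots> = g (x j) v"
      using j orthonormal_basis_square[OF x] by (simp add: sum.delta)
    finally show ?thesis by (simp add: g_simps j g_commute)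
  qed
  then have "v - (\<Sum>i=1..d. (g (x i) (x i) * g (x i) v) *v x i) = 0"
    using x unfolding orthonormal_basis_def by (intro g_zero_on_spanning) auto
  then show ?thesis by simp
qed

end

section \<open>Clifford modules\<close>

locale clifford_module =
  V: nondegenerate_symmetric_space scaleV BasisV g +
  S: finite_dimensional_vector_space scaleS BasisS
  for scaleV :: "'k::field \<Rightarrow> 'v::ab_group_add \<Rightarrow> 'v" (infixr "*v" 75)
    and BasisV :: "'v set" and g :: "'v \<Rightarrow> 'v \<Rightarrow> 'k"
    and scaleS :: "'k \<Rightarrow> 's::ab_group_add \<Rightarrow> 's" (infixr "*s" 75) and BasisS :: "'s set" +
  fixes act :: "'v \<Rightarrow> 's \<Rightarrow> 's" (infixr "\<bullet>" 76)
  assumes act_add_left: "(v + w) \<bullet> \<chi> = v \<bullet> \<chi> + w \<bullet> \<chi>"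
    and act_scale_left: "(a *v v) \<bullet> \<chi> = a *s (v \<bullet> \<chi>)"
    and act_add_right: "v \<bullet> (\<chi> + \<psi>) = v \<bullet> \<chi> + v \<bullet> \<psi>"
    and act_scale_right: "v \<bullet> (a *s \<chi>) = a *s (v \<bullet> \<chi>)"
    and clifford: "v \<bullet> w \<bullet> \<chi> + w \<bullet> v \<bullet> \<chi> = (2 * g v w) *s \<chi>"
begin

lemma linear_act_right: "Vector_Spaces.linear scaleS scaleS (\<lambda>\<chi>. v \<bullet> \<chi>)"
  by (simp add: Vector_Spaces.linear_iff S.vector_space_axioms act_add_right act_scale_right)

lemma linear_act_left: "Vector_Spaces.linear scaleV scaleS (\<lambda>v. v \<bullet> \<chi>)"
  by (simp add: Vector_Spaces.linear_iff S.vector_space_axioms V.vector_space_axioms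
      act_add_left act_scale_left)

lemma act_zero_right: "v \<bullet> 0 = 0"
  and act_minus_right: "v \<bullet> (- \<chi>) = - (v \<bullet> \<chi>)"
  and act_diff_right: "v \<bullet> (\<chi> - \<psi>) = v \<bullet> \<chi> - v \<bullet> \<psi>"
  and act_sum_right: "v \<bullet> (\<Sum>i\<in>I. f i) = (\<Sum>i\<in>I. v \<bullet> f i)"
proof -
  interpret l: Vector_Spaces.linear scaleS scaleS "\<lambda>\<chi>. v \<bullet> \<chi>" by (rule linear_act_right)
  show "v \<bullet> 0 = 0" "v \<bullet> (- \<chi>) = - (v \<bullet> \<chi>)" "v \<bullet> (\<chi> - \<psi>) = v \<bullet> \<chi> - v \<bullet> \<psi>"
    "v \<bullet> (\<Sum>i\<in>I. f i) = (\<Sum>i\<in>I. v \<bullet> f i)"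
    by (simp_all add: l.zero l.neg l.diff l.sum)
qed

lemma act_diff_left: "(v - w) \<bullet> \<chi> = v \<bullet> \<chi> - w \<bullet> \<chi>"
  and act_sum_left: "(\<Sum>i\<in>I. h i) \<bullet> \<chi> = (\<Sum>i\<in>I. h i \<bullet> \<chi>)"
proof -
  interpret l: Vector_Spaces.linear scaleV scaleS "\<lambda>v. v \<bullet> \<chi>" by (rule linear_act_left)
  show "(v - w) \<bullet> \<chi> = v \<bullet> \<chi> - w \<bullet> \<chi>" "(\<Sum>i\<in>I. h i) \<bullet> \<chi> = (\<Sum>i\<in>I. h i \<bullet> \<chi>)"
    by (simp_all add: l.diff l.sum)
qed

lemmas act_simps = act_add_left act_scale_left act_diff_left act_sum_left
  act_add_right act_scale_right act_zero_right act_minus_right act_diff_right act_sum_right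

lemma anticommute:
  assumes "g v w = 0"
  shows "v \<bullet> w \<bullet> \<chi> = - (w \<bullet> v \<bullet> \<chi>)"
  using clifford[of v w \<chi>] assms by (simp add: eq_neg_iff_add_eq_0)

lemma act_act_self: "v \<bullet> v \<bullet> \<chi> = g v v *s \<chi>"
proof -
  have "2 *s (v \<bullet> v \<bullet> \<chi>) = v \<bullet> v \<bullet> \<chi> + v \<bullet> v \<bullet> \<chi>"
    using S.scale_left_distrib[of 1 1 "v \<bullet> v \<bullet> \<chi>"] by simp
  also have "\<dots> = 2 *s (g v v *s \<chi>)" using clifford[of v v \<chi>] by simp
  finally show ?thesis using V.two_nonzero by (simp only: S.scale_cancel_left) simp
qed

subsection \<open>Vacuum vectors\<close>

definition stable :: "'s set \<Rightarrow> bool" where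
  "stable R \<longleftrightarrow> S.subspace R \<and> (\<forall>v. \<forall>\<chi>\<in>R. v \<bullet> \<chi> \<in> R)"

text \<open>In Fock space terms, the \<open>w\<^sub>i\<close> are annihilation operators.\<close>

definition vacua :: "(nat \<Rightarrow> 'v) \<Rightarrow> nat \<Rightarrow> 's set \<Rightarrow> 's set" where
  "vacua w m R = {\<chi>\<in>R. \<forall>i<m. w i \<bullet> \<chi> = 0}"

lemma subspace_vacua:
  assumes "stable R"
  shows "S.subspace (vacua w m R)"
  using assms unfolding stable_def S.subspace_def vacua_def by (auto simp: act_simps)

text \<open>Since \<open>w w' + w' w = 1\<close> for the pair \<open>w = w\<^sub>m\<close>, \<open>w' = w'\<^sub>m\<close>, the vectors killed by
  \<open>w\<^sub>0, \<dots>, w\<^bsub>m-1\<^esub>\<close> are the direct sum of those that \<open>w\<close> kills as well and of the image of the latter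
  under the injective map \<open>w'\<close>.\<close>

lemma dim_vacua_Suc:
  assumes h: "V.hyperbolic_pairs n w w'" and R: "stable R" and m: "m < n"
  shows "S.dim (vacua w m R) = 2 * S.dim (vacua w (Suc m) R)"
proof -
  let ?K = "vacua w (Suc m) R" and ?f = "\<lambda>\<chi>. w' m \<bullet> \<chi>"
  have gw: "g (w i) (w j) = 0" if "i < n" "j < n" for i j
    using h that unfolding V.hyperbolic_pairs_def by blast
  have gw': "2 * g (w i) (w' j) = (if i = j then 1 else 0)" if "i < n" "j < n" for i j
    using h that unfolding V.hyperbolic_pairs_def by blast
  have gww': "g (w i) (w' m) = 0" if "i < m" for i
    using gw'[of i m] that m V.two_nonzero by simp
  have one: "w m \<bullet> w' m \<bullet> \<chi> + w' m \<bullet> w m \<bullet> \<chi> = \<chi>" for \<chi>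
    using clifford[of "w m" "w' m" \<chi>] gw'[of m m] m by simp
  have subK: "S.subspace ?K" by (rule subspace_vacua[OF R])
  have lin: "Vector_Spaces.linear scaleS scaleS ?f" by (rule linear_act_right)
  have inj: "inj_on ?f (S.span ?K)"
  proof (rule inj_onI)
    fix \<chi> \<psi> assume "\<chi> \<in> S.span ?K" "\<psi> \<in> S.span ?K" and eq: "w' m \<bullet> \<chi> = w' m \<bullet> \<psi>"
    then have "\<chi> \<in> ?K" "\<psi> \<in> ?K" using S.span_eq_iff[THEN iffD2, OF subK] by auto
    then have "w m \<bullet> \<chi> = 0" "w m \<bullet> \<psi> = 0" by (auto simp: vacua_def)
    then show "\<chi> = \<psi>" using one[of \<chi>] one[of \<psi>] eq by (simp add: act_simps)
  qed
  interpret SS: finite_dimensional_vector_space_pair_1 scaleS BasisS scaleS ..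
  have dimf: "S.dim (?f ` ?K) = S.dim ?K" by (rule SS.dim_image_eq[OF lin inj])
  have subf: "S.subspace (?f ` ?K)" by (rule SS.linear_subspace_image[OF lin subK])
  have "?K \<inter> ?f ` ?K = {0}"
  proof -
    have "w' m \<bullet> \<chi> = 0" if "\<chi> \<in> ?K" "w' m \<bullet> \<chi> \<in> ?K" for \<chi>
      using one[of \<chi>] that by (auto simp: vacua_def act_simps)
    moreover have "0 \<in> ?K" "0 \<in> ?f ` ?K"
      using subK subf S.subspace_0 by auto
    ultimately show ?thesis by blast
  qed
  moreover have "vacua w m R = {x + y |x y. x \<in> ?K \<and> y \<in> ?f ` ?K}"
  proof (intro equalityI subsetI)
    fix \<chi> assume \<chi>: "\<chi> \<in> vacua w m R"
    \<comment> \<open>The decomposition \<open>\<chi> = w w' \<chi> + w' (w \<chi>)\<close>: both \<open>w w' \<chi>\<close> and \<open>w \<chi>\<close> are killed by \<open>w\<^sub>0, \<dots>, w\<^sub>m\<close>.\<close>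
    have kill: "w i \<bullet> w m \<bullet> \<chi> = 0" "w i \<bullet> w' m \<bullet> w m \<bullet> \<chi> = 0" "w i \<bullet> w m \<bullet> w' m \<bullet> \<chi> = 0"
      if "i < m" for i
      using that \<chi> m gw[of i m] gww'[of i]
      by (auto simp: vacua_def anticommute[of "w i" "w m"] anticommute[of "w i" "w' m"] act_simps)
    have "w m \<bullet> w m \<bullet> \<psi> = 0" for \<psi>
      using act_act_self[of "w m" \<psi>] gw m by simp
    then have "w m \<bullet> w' m \<bullet> \<chi> \<in> ?K" "w m \<bullet> \<chi> \<in> ?K"
      using kill \<chi> R unfolding vacua_def stable_def by (auto simp: less_Suc_eq)
    then show "\<chi> \<in> {x + y |x y. x \<in> ?K \<and> y \<in> ?f ` ?K}"
      using one[of \<chi>, symmetric] by blast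
  next
    fix \<chi> assume "\<chi> \<in> {x + y |x y. x \<in> ?K \<and> y \<in> ?f ` ?K}"
    then obtain x y where xy: "\<chi> = x + w' m \<bullet> y" "x \<in> ?K" "y \<in> ?K" by blast
    then have "w i \<bullet> w' m \<bullet> y = 0" if "i < m" for i
      using that gww' by (auto simp: vacua_def anticommute[of "w i" "w' m"] act_simps)
    then show "\<chi> \<in> vacua w m R"
      using xy R unfolding vacua_def stable_def by (auto simp: act_simps S.subspace_add)
  qed
  ultimately show ?thesis
    using S.dim_sums_Int[OF subK subf] dimf by simp
qed

lemma dim_stable:
  assumes "V.hyperbolic_pairs n w w'" "stable R" "m \<le> n"
  shows "S.dim R = 2 ^ m * S.dim (vacua w m R)"
  using assms(3)
proof (induction m)
  case 0
  then show ?case by (simp add: vacua_def)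
next
  case (Suc m)
  then show ?case using dim_vacua_Suc[OF assms(1,2), of m] by simp
qed

lemma stable_UNIV: "stable UNIV"
  by (simp add: stable_def)

text \<open>In dimension \<open>2\<^sup>n\<close>, the formula \<open>dim R = 2\<^sup>n dim(vacua in R)\<close> for \<open>R = S\<close> leaves dimension 1
  for the vacua.\<close>

lemma vacuum_line:
  assumes "V.hyperbolic_pairs n w w'" "card BasisS = 2 ^ n"
  shows "\<exists>u. u \<noteq> 0 \<and> u \<in> vacua w n UNIV \<and> (\<forall>\<chi>\<in>vacua w n UNIV. \<exists>c. \<chi> = c *s u)"
proof -
  have "S.dim (vacua w n UNIV) = 1"
    using dim_stable[OF assms(1) stable_UNIV order_refl] assms(2) by (simp add: S.dim_UNIV)
  then obtain A where A: "A \<subseteq> vacua w n UNIV" "S.independent A" "vacua w n UNIV \<subseteq> S.span A" "card A = 1"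
    using S.basis_exists[of "vacua w n UNIV"] by metis
  then obtain u where "A = {u}" by (auto simp: card_1_singleton_iff)
  with A show ?thesis
    by (auto simp: S.span_singleton intro!: exI[of _ u])
qed

text \<open>A submodule with a nonzero vacuum has dimension at least \<open>2\<^sup>n\<close> by the same formula.\<close>

lemma stable_eq_UNIV:
  assumes h: "V.hyperbolic_pairs n w w'" and card: "card BasisS = 2 ^ n" and R: "stable R"
    and u: "u \<in> R" "u \<in> vacua w n UNIV" "u \<noteq> 0"
  shows "R = UNIV"
proof -
  have "{u} \<subseteq> vacua w n R" using u by (auto simp: vacua_def)
  then have "1 \<le> S.dim (vacua w n R)"
    using S.independent_card_le_dim[of "{u}"] u(3) by simp
  then have "2 ^ n \<le> S.dim R"
    using dim_stable[OF h R order_refl] by simp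
  then show ?thesis
    using S.subspace_dim_equal[of R UNIV] R card by (simp add: stable_def S.dim_UNIV)
qed

subsection \<open>Products of vectors\<close>

abbreviation act_list :: "'v list \<Rightarrow> 's \<Rightarrow> 's" where
  "act_list vs \<equiv> foldr act vs"

lemma act_act_list_orthogonal:
  assumes "\<forall>x\<in>set vs. g v x = 0"
  shows "v \<bullet> act_list vs \<chi> = (- 1) ^ length vs *s act_list vs (v \<bullet> \<chi>)"
  using assms
  by (induction vs) (auto simp: anticommute[of v] act_simps)

lemma act_list_zero: "act_list vs 0 = 0"
  by (induction vs) (auto simp: act_simps)

text \<open>Reversing \<open>k\<close> anticommuting factors takes \<open>k(k-1)/2\<close> transpositions.\<close>

lemma act_list_rev:
  assumes "\<forall>v\<in>set vs. \<forall>x\<in>set vs. g v x = 0"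
  shows "act_list (rev vs) \<chi> = (- 1) ^ (length vs * (length vs - 1) div 2) *s act_list vs \<chi>"
  using assms
proof (induction vs arbitrary: \<chi>)
  case (Cons v vs)
  let ?l = "length vs"
  have "even (?l * (?l - 1))" by (cases ?l) auto
  moreover have "Suc ?l * ?l = ?l * (?l - 1) + 2 * ?l" by (cases ?l) auto
  ultimately have e: "Suc ?l * ?l div 2 = ?l * (?l - 1) div 2 + ?l" by simp
  have "v \<bullet> act_list vs \<chi> = (- 1) ^ ?l *s act_list vs (v \<bullet> \<chi>)"
    using Cons.prems by (intro act_act_list_orthogonal) auto
  moreover have "act_list (rev vs) (v \<bullet> \<chi>) = (- 1) ^ (?l * (?l - 1) div 2) *s act_list vs (v \<bullet> \<chi>)"
    using Cons by simp
  ultimately show ?case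
    by (simp add: e power_add del: mult_Suc flip: power_mult_distrib)
qed simp

text \<open>Moving \<open>v\<close> through the anticommuting factors to its own occurrence produces \<open>v\<^sup>2 = g(v,v) = 0\<close>.\<close>

lemma act_act_list_isotropic:
  assumes "v \<in> set vs" "\<forall>v\<in>set vs. \<forall>x\<in>set vs. g v x = 0"
  shows "v \<bullet> act_list vs \<chi> = 0"
  using assms
proof (induction vs)
  case (Cons x vs)
  show ?case
  proof (cases "v = x")
    case True
    then show ?thesis using Cons.prems act_act_self[of x] by simp
  next
    case False
    then have "v \<bullet> act_list vs \<chi> = 0" "g v x = 0" using Cons by auto
    then show ?thesis by (simp add: anticommute[of v x] act_simps)
  qed
qed simp

text \<open>The product of the \<open>w\<^sub>i\<close> is nonzero as an operator: the \<open>w'\<^sub>i\<close> create from a vacuum vector a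
  state which it annihilates back to the vacuum.\<close>

lemma annihilate_created:
  assumes h: "V.hyperbolic_pairs n w w'" and u: "u \<in> vacua w n UNIV" and "m \<le> n"
  shows "act_list (map w [0..<m]) (act_list (rev (map w' [0..<m])) u) = u"
  using assms(3)
proof (induction m)
  case (Suc m)
  let ?\<chi> = "act_list (rev (map w' [0..<m])) u"
  have gww': "2 * g (w m) (w' i) = (if m = i then 1 else 0)" if "i \<le> m" for i
    using h that Suc.prems unfolding V.hyperbolic_pairs_def by auto
  then have "g (w m) (w' i) = 0" if "i < m" for i
    using V.two_nonzero that by (metis less_imp_le mult_eq_0_iff nat_neq_iff)
  then have "w m \<bullet> ?\<chi> = (- 1) ^ m *s act_list (rev (map w' [0..<m])) (w m \<bullet> u)"
    by (subst act_act_list_orthogonal) auto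
  also have "w m \<bullet> u = 0" using u Suc.prems by (simp add: vacua_def)
  finally have "w m \<bullet> w' m \<bullet> ?\<chi> = ?\<chi>"
    using clifford[of "w m" "w' m" ?\<chi>] gww'[of m] by (simp add: act_simps act_list_zero)
  then show ?case using Suc by simp
qed simp

end

section \<open>Spinor norms\<close>

locale clifford_module_form =
  clifford_module scaleV BasisV g scaleS BasisS act
  for scaleV :: "'k::field \<Rightarrow> 'v::ab_group_add \<Rightarrow> 'v" (infixr "*v" 75)
    and BasisV :: "'v set" and g :: "'v \<Rightarrow> 'v \<Rightarrow> 'k"
    and scaleS :: "'k \<Rightarrow> 's::ab_group_add \<Rightarrow> 's" (infixr "*s" 75) and BasisS :: "'s set"
    and act :: "'v \<Rightarrow> 's \<Rightarrow> 's" (infixr "\<bullet>" 76) +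
  fixes B :: "'s \<Rightarrow> 's \<Rightarrow> 'k"
  assumes bilinear_B: "bilinear_form scaleS B"
    and B_act: "B (v \<bullet> \<phi>) \<psi> = B \<phi> (v \<bullet> \<psi>)"
begin

lemma B_add_right: "B \<phi> (\<psi> + \<chi>) = B \<phi> \<psi> + B \<phi> \<chi>"
  and B_scale_right: "B \<phi> (a *s \<psi>) = a * B \<phi> \<psi>"
  and B_sum_right: "B \<phi> (\<Sum>i\<in>I. f i) = (\<Sum>i\<in>I. B \<phi> (f i))"
  and B_zero_right: "B \<phi> 0 = 0"
  and B_minus_right: "B \<phi> (- \<psi>) = - B \<phi> \<psi>"
proof -
  interpret l: Vector_Spaces.linear scaleS "(*)" "B \<phi>"
    using bilinear_B by (simp add: bilinear_form_def)
  show "B \<phi> (\<psi> + \<chi>) = B \<phi> \<psi> + B \<phi> \<chi>" "B \<phi> (a *s \<psi>) = a * B \<phi> \<psi>"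
    "B \<phi> (\<Sum>i\<in>I. f i) = (\<Sum>i\<in>I. B \<phi> (f i))" "B \<phi> 0 = 0"
    "B \<phi> (- \<psi>) = - B \<phi> \<psi>"
    by (simp_all add: l.add l.scale l.sum l.zero l.neg)
qed

lemma B_add_left: "B (\<psi> + \<chi>) \<phi> = B \<psi> \<phi> + B \<chi> \<phi>"
  and B_scale_left: "B (a *s \<psi>) \<phi> = a * B \<psi> \<phi>"
  and B_zero_left: "B 0 \<phi> = 0"
proof -
  interpret l: Vector_Spaces.linear scaleS "(*)" "\<lambda>\<psi>. B \<psi> \<phi>"
    using bilinear_B by (simp add: bilinear_form_def)
  show "B (\<psi> + \<chi>) \<phi> = B \<psi> \<phi> + B \<chi> \<phi>" "B (a *s \<psi>) \<phi> = a * B \<psi> \<phi>" "B 0 \<phi> = 0"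
    by (simp_all add: l.add l.scale l.zero)
qed

lemmas B_simps = B_add_right B_scale_right B_sum_right B_zero_right B_minus_right
  B_add_left B_scale_left B_zero_left

lemma B_act_list: "B (act_list vs \<phi>) \<psi> = B \<phi> (act_list (rev vs) \<psi>)"
  by (induction vs arbitrary: \<psi>) (auto simp: B_act)

text \<open>Let \<open>\<nu>\<close> be the product of the \<open>w\<^sub>i\<close>, \<open>u\<close> a nonzero vacuum and \<open>\<nu>\<chi> = l(\<chi>) u\<close>. Moving \<open>\<nu>\<close> across \<open>B\<close> gives
  \<open>l(\<phi>) B(u,\<psi>) = \<epsilon> l(\<psi>) B(\<phi>,u)\<close>. Inserting a spinor \<open>\<omega>\<close> with \<open>l(\<omega>) = 1\<close> on either side expresses both
  \<open>B(u,\<psi>)\<close> and \<open>\<epsilon> B(\<psi>,u)\<close> as \<open>l(\<psi>) B(u,\<omega>)\<close>. So the symmetry holds when one argument is \<open>u\<close>, and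
  the spinors with this property form a submodule.\<close>

theorem B_symmetry:
  assumes h: "V.hyperbolic_pairs n w w'" and card: "card BasisS = 2 ^ n"
  shows "B \<psi> \<phi> = (- 1) ^ (n * (n - 1) div 2) * B \<phi> \<psi>"
proof -
  define \<epsilon> :: 'k where "\<epsilon> = (- 1) ^ (n * (n - 1) div 2)"
  have \<epsilon>2: "\<epsilon> * \<epsilon> = 1" by (simp add: \<epsilon>_def flip: power_mult_distrib)
  let ?ws = "map w [0..<n]"
  have iso: "\<forall>v\<in>set ?ws. \<forall>x\<in>set ?ws. g v x = 0"
    using h unfolding V.hyperbolic_pairs_def by auto
  obtain u where u: "u \<noteq> 0" "u \<in> vacua w n UNIV"
    and line: "\<And>\<chi>. \<chi> \<in> vacua w n UNIV \<Longrightarrow> \<exists>c. \<chi> = c *s u"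
    using vacuum_line[OF h card] by blast
  define \<omega> where "\<omega> = act_list (rev (map w' [0..<n])) u"
  have \<omega>: "act_list ?ws \<omega> = u"
    unfolding \<omega>_def by (rule annihilate_created[OF h u(2) order_refl])
  have "act_list ?ws \<chi> \<in> vacua w n UNIV" for \<chi>
    using act_act_list_isotropic[OF _ iso] by (simp add: vacua_def)
  then have "\<forall>\<chi>. \<exists>c. act_list ?ws \<chi> = c *s u"
    using line by blast
  then obtain l where l: "\<And>\<chi>. act_list ?ws \<chi> = l \<chi> *s u"
    by metis
  have l\<omega>: "l \<omega> = 1"
    using \<omega> l[of \<omega>] u(1) S.scale_cancel_right[of "l \<omega>" u 1] by simp
  have move: "l \<phi> * B u \<psi> = \<epsilon> * l \<psi> * B \<phi> u" for \<phi> \<psi>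
    using B_act_list[of ?ws \<phi> \<psi>] by (simp add: act_list_rev[OF iso] l B_simps \<epsilon>_def)
  have sym_u: "B u \<psi> = \<epsilon> * B \<psi> u" for \<psi>
  proof -
    have "B u \<psi> = l \<psi> * (\<epsilon> * B \<omega> u)" using move[of \<omega> \<psi>] l\<omega> by simp
    also have "\<epsilon> * B \<omega> u = B u \<omega>" using move[of \<omega> \<omega>] l\<omega> by simp
    also have "l \<psi> * B u \<omega> = \<epsilon> * B \<psi> u" using move[of \<psi> \<omega>] l\<omega> by simp
    finally show ?thesis .
  qed
  let ?R = "{\<chi>. \<forall>\<psi>. B \<chi> \<psi> = \<epsilon> * B \<psi> \<chi>}"
  have "stable ?R"
    unfolding stable_def S.subspace_def by (auto simp: B_simps B_act algebra_simps)
  then have "?R = UNIV"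
    using stable_eq_UNIV[OF h card _ _ u(2,1)] sym_u by simp
  then show ?thesis unfolding \<epsilon>_def by blast
qed

end

section \<open>Contraction over orthonormal bases\<close>

context clifford_module
begin

text \<open>The tensor \<open>\<Sum>\<^sub>i g(x\<^sub>i,x\<^sub>i) x\<^sub>i \<otimes> x\<^sub>i\<close> is the inverse of \<open>g\<close>, so it is the same for all
  orthonormal bases; here it is contracted with a bilinear map \<open>H\<close>.\<close>

lemma contraction_basis_independent:
  assumes x: "orthonormal_basis scaleV g d x" and y: "orthonormal_basis scaleV g d y"
    and H_left: "\<And>w. Vector_Spaces.linear scaleV scaleS (\<lambda>v. H v w)"
    and H_right: "\<And>v. Vector_Spaces.linear scaleV scaleS (H v)"
  shows "(\<Sum>i=1..d. g (x i) (x i) *s H (x i) (x i)) = (\<Sum>i=1..d. g (y i) (y i) *s H (y i) (y i))"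
proof -
  have left: "H (\<Sum>i\<in>I. a i *v z i) w = (\<Sum>i\<in>I. a i *s H (z i) w)"
    for I :: "nat set" and a z w
  proof -
    interpret l: Vector_Spaces.linear scaleV scaleS "\<lambda>v. H v w" by (rule H_left)
    show ?thesis by (simp add: l.sum l.scale)
  qed
  have right: "H w (\<Sum>i\<in>I. a i *v z i) = (\<Sum>i\<in>I. a i *s H w (z i))"
    for I :: "nat set" and a z w
  proof -
    interpret l: Vector_Spaces.linear scaleV scaleS "H w" by (rule H_right)
    show ?thesis by (simp add: l.sum l.scale)
  qed
  have "(\<Sum>j=1..d. g (y j) (y j) *s H (y j) (y j))
      = (\<Sum>j=1..d. g (y j) (y j) *s H (y j) (\<Sum>i=1..d. (g (x i) (x i) * g (x i) (y j)) *v x i))"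
    using V.orthonormal_basis_expansion[OF x] by simp
  also have "\<dots> = (\<Sum>j=1..d. \<Sum>i=1..d. (g (y j) (y j) * g (x i) (x i) * g (x i) (y j)) *s H (y j) (x i))"
    unfolding right by (simp add: S.scale_sum_right mult.assoc)
  also have "\<dots> = (\<Sum>i=1..d. \<Sum>j=1..d. (g (y j) (y j) * g (x i) (x i) * g (x i) (y j)) *s H (y j) (x i))"
    by (rule sum.swap)
  also have "\<dots> = (\<Sum>i=1..d. g (x i) (x i) *s H (\<Sum>j=1..d. (g (y j) (y j) * g (y j) (x i)) *v y j) (x i))"
    unfolding left by (simp add: S.scale_sum_right V.g_commute[of "x _" "y _"] ac_simps)
  also have "\<dots> = (\<Sum>i=1..d. g (x i) (x i) *s H (x i) (x i))"
    using V.orthonormal_basis_expansion[OF y] by simp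
  finally show ?thesis by simp
qed

end

section \<open>The dual vector and the bivector of two spinors\<close>

context clifford_module_form
begin

text \<open>The values \<open>\<phi>\<^sup>*(\<psi>)\<close> and the operators by which \<open>tilde_L2(\<phi>,\<psi>)\<close> acts on spinors, computed in a
  basis \<open>x\<close>.\<close>

definition dual :: "nat \<Rightarrow> (nat \<Rightarrow> 'v) \<Rightarrow> 's \<Rightarrow> 's \<Rightarrow> 'v" where
  "dual d x \<phi> \<psi> = (\<Sum>i=1..d. (g (x i) (x i) * B \<phi> (x i \<bullet> \<psi>)) *v x i)"

definition bivector :: "nat \<Rightarrow> (nat \<Rightarrow> 'v) \<Rightarrow> 's \<Rightarrow> 's \<Rightarrow> 's \<Rightarrow> 's" where
  "bivector d x \<phi> \<psi> \<chi> =
     (1 / 2) *s (\<Sum>(i, j)\<in>{(i, j). 1 \<le> i \<and> i < j \<and> j \<le> d}.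
       (g (x i) (x i) * g (x j) (x j) * B \<phi> (x j \<bullet> x i \<bullet> \<psi>)) *s (x i \<bullet> x j \<bullet> \<chi>))"

lemma B_act_expansion:
  assumes x: "orthonormal_basis scaleV g d x"
  shows "B \<phi> (v \<bullet> \<psi>) = (\<Sum>i=1..d. g (x i) (x i) * g (x i) v * B \<phi> (x i \<bullet> \<psi>))"
proof -
  have "B \<phi> (v \<bullet> \<psi>) = B \<phi> ((\<Sum>i=1..d. (g (x i) (x i) * g (x i) v) *v x i) \<bullet> \<psi>)"
    using V.orthonormal_basis_expansion[OF x, of v] by simp
  then show ?thesis by (simp add: act_simps B_simps)
qed

lemma g_dual:
  assumes x: "orthonormal_basis scaleV g d x"
  shows "g (dual d x \<phi> \<psi>) v = B \<phi> (v \<bullet> \<psi>)"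
  by (simp add: dual_def V.g_simps B_act_expansion[OF x, of \<phi> v] ac_simps)

lemma dual_basis_independent:
  assumes "orthonormal_basis scaleV g d x" "orthonormal_basis scaleV g d y"
  shows "dual d x \<phi> \<psi> = dual d y \<phi> \<psi>"
  by (rule V.eq_if_g_eq) (simp add: g_dual assms)

text \<open>Exchanging \<open>i \<noteq> j\<close> changes the sign both of \<open>x\<^sub>j x\<^sub>i\<close> inside \<open>B\<close> and of \<open>x\<^sub>i x\<^sub>j\<close> outside, so the
  off-diagonal terms are symmetric; each of the \<open>d\<close> diagonal terms is \<open>B(\<phi>,\<psi>) \<chi>\<close>. The full sum,
  unlike the sum over \<open>i < j\<close>, is bilinear in two copies of the basis.\<close>

lemma bivector_full_sum:
  assumes x: "orthonormal_basis scaleV g d x"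
  shows "4 *s bivector d x \<phi> \<psi> \<chi> =
    (\<Sum>i=1..d. \<Sum>j=1..d. (g (x i) (x i) * g (x j) (x j) * B \<phi> (x j \<bullet> x i \<bullet> \<psi>)) *s (x i \<bullet> x j \<bullet> \<chi>))
    - (of_nat d * B \<phi> \<psi>) *s \<chi>"
proof -
  define T where "T i j = (g (x i) (x i) * g (x j) (x j) * B \<phi> (x j \<bullet> x i \<bullet> \<psi>)) *s (x i \<bullet> x j \<bullet> \<chi>)"
    for i j
  let ?I = "{1..d}" and ?P = "{(i, j). 1 \<le> i \<and> i < j \<and> j \<le> d}"
  let ?Q = "prod.swap ` ?P" and ?D = "(\<lambda>i. (i, i)) ` ?I"
  have P: "?P \<subseteq> ?I \<times> ?I" by auto
  then have finP: "finite ?P" by (rule finite_subset) simp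
  have sym: "T j i = T i j" if "i \<in> ?I" "j \<in> ?I" "i \<noteq> j" for i j
  proof -
    have "g (x i) (x j) = 0"
      using x that unfolding orthonormal_basis_def by auto
    then have "x i \<bullet> x j \<bullet> \<eta> = - (x j \<bullet> x i \<bullet> \<eta>)" for \<eta> by (rule anticommute)
    then show ?thesis unfolding T_def
      by (simp add: mult.commute[of "g (x i) (x i)"] B_simps)
  qed
  have diag: "T i i = B \<phi> \<psi> *s \<chi>" if "i \<in> ?I" for i
    using V.orthonormal_basis_square[OF x that] by (simp add: T_def act_act_self B_simps)
  have split: "?I \<times> ?I = ?P \<union> (?Q \<union> ?D)"
    by (auto simp: image_iff)
  have "(\<Sum>i\<in>?I. \<Sum>j\<in>?I. T i j) = (\<Sum>(i, j)\<in>?P \<union> (?Q \<union> ?D). T i j)"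
    unfolding split[symmetric] by (simp add: sum.cartesian_product)
  also have "\<dots> = (\<Sum>(i, j)\<in>?P. T i j) + (\<Sum>(i, j)\<in>?Q \<union> ?D. T i j)"
    using finP by (intro sum.union_disjoint) auto
  also have "(\<Sum>(i, j)\<in>?Q \<union> ?D. T i j) = (\<Sum>(i, j)\<in>?Q. T i j) + (\<Sum>(i, j)\<in>?D. T i j)"
    using finP by (intro sum.union_disjoint) auto
  also have "(\<Sum>(i, j)\<in>?Q. T i j) = (\<Sum>(i, j)\<in>?P. T j i)"
    by (subst sum.reindex) (auto intro!: sum.cong)
  also have "\<dots> = (\<Sum>(i, j)\<in>?P. T i j)"
    by (rule sum.cong) (auto simp: sym)
  also have "(\<Sum>(i, j)\<in>?D. T i j) = (\<Sum>i\<in>?I. T i i)"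
    by (subst sum.reindex) (auto simp: inj_on_def)
  also have "\<dots> = (of_nat d * B \<phi> \<psi>) *s \<chi>"
    using diag S.sum_constant_scale[of "B \<phi> \<psi> *s \<chi>" ?I] by simp
  finally have "(\<Sum>i\<in>?I. \<Sum>j\<in>?I. T i j) - (of_nat d * B \<phi> \<psi>) *s \<chi>
      = (\<Sum>(i, j)\<in>?P. T i j) + (\<Sum>(i, j)\<in>?P. T i j)"
    by (simp add: algebra_simps)
  also have "\<dots> = 2 *s (\<Sum>(i, j)\<in>?P. T i j)"
    using S.scale_left_distrib[of 1 1 "\<Sum>(i, j)\<in>?P. T i j"] by simp
  also have "\<dots> = 4 *s bivector d x \<phi> \<psi> \<chi>"
    unfolding bivector_def T_def using V.two_nonzero
    by (simp add: field_simps) 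
  finally show ?thesis unfolding T_def ..
qed

lemma four_nonzero: "(4::'k) \<noteq> 0"
proof -
  have "(4::'k) = 2 * 2" by simp
  then show ?thesis using V.two_nonzero by (metis mult_eq_0_iff)
qed

text \<open>The full sum contracts a map of four vector arguments with the inverse of \<open>g\<close> twice, and each
  contraction allows a change of basis.\<close>

lemma bivector_basis_independent:
  assumes x: "orthonormal_basis scaleV g d x" and y: "orthonormal_basis scaleV g d y"
  shows "bivector d x \<phi> \<psi> \<chi> = bivector d y \<phi> \<psi> \<chi>"
proof -
  define F where "F a b c e = B \<phi> (c \<bullet> a \<bullet> \<psi>) *s (b \<bullet> e \<bullet> \<chi>)" for a b c e
  have lin: "Vector_Spaces.linear scaleV scaleS f \<longleftrightarrow>
      (\<forall>v w. f (v + w) = f v + f w) \<and> (\<forall>a v. f (a *v v) = a *s f v)" for f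
    by (simp add: Vector_Spaces.linear_iff S.vector_space_axioms V.vector_space_axioms)
  have inner: "(\<Sum>j=1..d. g (x j) (x j) *s F a b (x j) (x j)) = (\<Sum>j=1..d. g (y j) (y j) *s F a b (y j) (y j))" for a b
    by (rule contraction_basis_independent[OF x y])
      (auto simp: lin F_def act_simps B_simps S.scale_left_distrib S.scale_right_distrib)
  have outer: "(\<Sum>i=1..d. g (x i) (x i) *s (\<Sum>j=1..d. g (y j) (y j) *s F (x i) (x i) (y j) (y j)))
      = (\<Sum>i=1..d. g (y i) (y i) *s (\<Sum>j=1..d. g (y j) (y j) *s F (y i) (y i) (y j) (y j)))"
    by (rule contraction_basis_independent[OF x y,
          where H = "\<lambda>a b. \<Sum>j=1..d. g (y j) (y j) *s F a b (y j) (y j)"])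
      (auto simp: lin F_def act_simps B_simps S.scale_left_distrib S.scale_right_distrib
        sum.distrib S.scale_sum_right distrib_left ac_simps)
  have full: "(\<Sum>i=1..d. \<Sum>j=1..d. (g (z i) (z i) * g (z j) (z j) * B \<phi> (z j \<bullet> z i \<bullet> \<psi>)) *s (z i \<bullet> z j \<bullet> \<chi>))
      = (\<Sum>i=1..d. g (z i) (z i) *s (\<Sum>j=1..d. g (z j) (z j) *s F (z i) (z i) (z j) (z j)))" for z
    by (simp add: F_def S.scale_sum_right mult.assoc)
  have "4 *s bivector d x \<phi> \<psi> \<chi> = 4 *s bivector d y \<phi> \<psi> \<chi>"
    unfolding bivector_full_sum[OF x] bivector_full_sum[OF y] full inner outer ..
  then show ?thesis using four_nonzero by simp
qed

text \<open>This is \<open>[v w, u] = 2 g(w,u) v - 2 g(v,u) w\<close>: move \<open>u\<close> to the left past \<open>w\<close>, then past \<open>v\<close>.\<close>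

lemma act_act_act_commutator:
  "v \<bullet> w \<bullet> u \<bullet> \<chi> - u \<bullet> v \<bullet> w \<bullet> \<chi> = (2 * g w u) *s (v \<bullet> \<chi>) - (2 * g v u) *s (w \<bullet> \<chi>)"
proof -
  have 1: "v \<bullet> (w \<bullet> u \<bullet> \<chi> + u \<bullet> w \<bullet> \<chi>) = (2 * g w u) *s (v \<bullet> \<chi>)"
    unfolding clifford by (simp add: act_simps)
  have 2: "v \<bullet> u \<bullet> (w \<bullet> \<chi>) + u \<bullet> v \<bullet> (w \<bullet> \<chi>) = (2 * g v u) *s (w \<bullet> \<chi>)"
    by (rule clifford)
  show ?thesis unfolding 1[symmetric] 2[symmetric] by (simp add: act_simps)
qed

text \<open>Contracting the index \<open>j\<close> of \<open>B(\<phi>, x\<^sub>j x\<^sub>i \<cdot> \<psi>)\<close> with \<open>v\<close> gives \<open>B(\<phi>, v x\<^sub>i \<cdot> \<psi>) = \<epsilon> B(\<psi>, x\<^sub>i v \<cdot> \<phi>)\<close>, a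
  coefficient of \<open>\<epsilon> \<psi>\<^sup>*(v \<cdot> \<phi>)\<close>; contracting \<open>i\<close> gives \<open>B(\<phi>, x\<^sub>j v \<cdot> \<psi>)\<close>, a coefficient of
  \<open>\<phi>\<^sup>*(v \<cdot> \<psi>)\<close>. The multiple of the identity in the bivector drops out of the commutator.\<close>

theorem bivector_commutator:
  assumes x: "orthonormal_basis scaleV g d x"
    and sym: "\<And>\<phi> \<psi>. B \<psi> \<phi> = \<epsilon> * B \<phi> \<psi>"
  shows "2 *s (bivector d x \<phi> \<psi> (v \<bullet> \<chi>) - v \<bullet> bivector d x \<phi> \<psi> \<chi>)
    = (\<epsilon> *v dual d x \<psi> (v \<bullet> \<phi>) - dual d x \<phi> (v \<bullet> \<psi>)) \<bullet> \<chi>"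
proof -
  let ?I = "{1..d}"
  define c where "c i j = g (x i) (x i) * g (x j) (x j) * B \<phi> (x j \<bullet> x i \<bullet> \<psi>)" for i j
  have 1: "(\<Sum>j\<in>?I. c i j * g (x j) v) = g (x i) (x i) * \<epsilon> * B \<psi> (x i \<bullet> v \<bullet> \<phi>)" for i
  proof -
    have "(\<Sum>j\<in>?I. c i j * g (x j) v) = g (x i) (x i) * B \<phi> (v \<bullet> x i \<bullet> \<psi>)"
      unfolding B_act_expansion[OF x, of \<phi> v] c_def by (simp add: sum_distrib_left ac_simps)
    also have "B \<phi> (v \<bullet> x i \<bullet> \<psi>) = B (x i \<bullet> v \<bullet> \<phi>) \<psi>" by (simp add: B_act)
    also have "\<dots> = \<epsilon> * B \<psi> (x i \<bullet> v \<bullet> \<phi>)" by (rule sym)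
    finally show ?thesis by (simp add: ac_simps)
  qed
  have 2: "(\<Sum>i\<in>?I. c i j * g (x i) v) = g (x j) (x j) * B \<phi> (x j \<bullet> v \<bullet> \<psi>)" for j
  proof -
    have "B \<phi> (x j \<bullet> v \<bullet> \<psi>) = B (x j \<bullet> \<phi>) (v \<bullet> \<psi>)" by (simp add: B_act)
    also have "\<dots> = (\<Sum>i\<in>?I. g (x i) (x i) * g (x i) v * B \<phi> (x j \<bullet> x i \<bullet> \<psi>))"
      unfolding B_act_expansion[OF x, of "x j \<bullet> \<phi>" v] by (simp add: B_act)
    finally show ?thesis by (simp add: c_def sum_distrib_left ac_simps)
  qed
  have "4 *s (bivector d x \<phi> \<psi> (v \<bullet> \<chi>) - v \<bullet> bivector d x \<phi> \<psi> \<chi>)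
      = 4 *s bivector d x \<phi> \<psi> (v \<bullet> \<chi>) - v \<bullet> (4 *s bivector d x \<phi> \<psi> \<chi>)"
    by (simp add: act_simps S.scale_right_diff_distrib)
  also have "\<dots> = (\<Sum>i\<in>?I. \<Sum>j\<in>?I. c i j *s (x i \<bullet> x j \<bullet> v \<bullet> \<chi> - v \<bullet> x i \<bullet> x j \<bullet> \<chi>))"
    unfolding bivector_full_sum[OF x] c_def
    by (simp add: act_simps S.scale_right_diff_distrib sum_subtractf)
  also have "\<dots> = 2 *s ((\<Sum>i\<in>?I. \<Sum>j\<in>?I. (c i j * g (x j) v) *s (x i \<bullet> \<chi>))
      - (\<Sum>i\<in>?I. \<Sum>j\<in>?I. (c i j * g (x i) v) *s (x j \<bullet> \<chi>)))"
    unfolding act_act_act_commutator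
    by (simp add: S.scale_right_diff_distrib sum_subtractf S.scale_sum_right ac_simps)
  also have "(\<Sum>i\<in>?I. \<Sum>j\<in>?I. (c i j * g (x j) v) *s (x i \<bullet> \<chi>)) = (\<epsilon> *v dual d x \<psi> (v \<bullet> \<phi>)) \<bullet> \<chi>"
    unfolding S.scale_sum_left[symmetric] 1
    by (simp add: dual_def act_simps S.scale_sum_right ac_simps)
  also have "(\<Sum>i\<in>?I. \<Sum>j\<in>?I. (c i j * g (x i) v) *s (x j \<bullet> \<chi>)) = dual d x \<phi> (v \<bullet> \<psi>) \<bullet> \<chi>"
    by (subst sum.swap, unfold S.scale_sum_left[symmetric] 2) (simp add: dual_def act_simps)
  finally have "2 *s (2 *s (bivector d x \<phi> \<psi> (v \<bullet> \<chi>) - v \<bullet> bivector d x \<phi> \<psi> \<chi>))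
    = 2 *s ((\<epsilon> *v dual d x \<psi> (v \<bullet> \<phi>) - dual d x \<phi> (v \<bullet> \<psi>)) \<bullet> \<chi>)"
    by (simp add: act_simps)
  then show ?thesis using V.two_nonzero S.scale_cancel_left by blast
qed

text \<open>Paired with \<open>u\<close>, both sides become \<open>B(\<phi>, (v u + u v) \<cdot> \<psi>)\<close>.\<close>

theorem dual_sum:
  assumes x: "orthonormal_basis scaleV g d x"
    and sym: "\<And>\<phi> \<psi>. B \<psi> \<phi> = \<epsilon> * B \<phi> \<psi>"
  shows "(2 * B \<phi> \<psi>) *v v = \<epsilon> *v dual d x \<psi> (v \<bullet> \<phi>) + dual d x \<phi> (v \<bullet> \<psi>)"
proof (rule V.eq_if_g_eq)
  fix u
  have "\<epsilon> * B \<psi> (u \<bullet> v \<bullet> \<phi>) = B (u \<bullet> v \<bullet> \<phi>) \<psi>" by (rule sym[symmetric])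
  also have "\<dots> = B \<phi> (v \<bullet> u \<bullet> \<psi>)" by (simp add: B_act)
  finally have "\<epsilon> * B \<psi> (u \<bullet> v \<bullet> \<phi>) + B \<phi> (u \<bullet> v \<bullet> \<psi>) = B \<phi> (v \<bullet> u \<bullet> \<psi> + u \<bullet> v \<bullet> \<psi>)"
    by (simp add: B_simps)
  then show "g ((2 * B \<phi> \<psi>) *v v) u = g (\<epsilon> *v dual d x \<psi> (v \<bullet> \<phi>) + dual d x \<phi> (v \<bullet> \<psi>)) u"
    by (simp add: V.g_simps g_dual[OF x] V.g_commute[of v u] clifford B_simps ac_simps)
qed

end

section \<open>The Clifford algebra as a quotient ring\<close>

lemma ring_ring_of_type_algebra: "ring (ring_of_type_algebra :: 'a::ring_1 ring)"
proof -
  have "\<exists>y. x + y = 0" for x :: 'a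
    using add.right_inverse by blast
  then show ?thesis
    unfolding ring_of_type_algebra_def using add.right_inverse
    by unfold_locales (auto simp: algebra_simps Units_def)
qed

lemma ideal_clifford_ideal: "ideal (clifford_ideal sV g) ring_of_type_algebra"
  unfolding clifford_ideal_def
  by (intro ring.genideal_ideal ring_ring_of_type_algebra) (simp add: ring_of_type_algebra_def)

lemma ring_clifford_algebra: "ring (clifford_algebra sV g)"
  unfolding clifford_algebra_def by (intro ideal.quotient_is_ring ideal_clifford_ideal)

lemma clifford_class_hom:
  "clifford_class sV g \<in> ring_hom ring_of_type_algebra (clifford_algebra sV g)"
  unfolding clifford_class_def[abs_def] clifford_algebra_def
  by (intro ideal.rcos_ring_hom ideal_clifford_ideal)

lemma clifford_class_closed: "clifford_class sV g t \<in> carrier (clifford_algebra sV g)"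
  using ring_hom_closed[OF clifford_class_hom] by (simp add: ring_of_type_algebra_def)

lemma clifford_class_add:
  "clifford_class sV g (s + t) = clifford_class sV g s \<oplus>\<^bsub>clifford_algebra sV g\<^esub> clifford_class sV g t"
  using ring_hom_add[OF clifford_class_hom] by (simp add: ring_of_type_algebra_def)

lemma clifford_class_mult:
  "clifford_class sV g (s * t) = clifford_class sV g s \<otimes>\<^bsub>clifford_algebra sV g\<^esub> clifford_class sV g t"
  using ring_hom_mult[OF clifford_class_hom] by (simp add: ring_of_type_algebra_def)

lemma clifford_class_relation:
  assumes "r \<in> clifford_relations sV g"
  shows "clifford_class sV g r = \<zero>\<^bsub>clifford_algebra sV g\<^esub>"
proof -
  have "r \<in> clifford_ideal sV g"
    unfolding clifford_ideal_def
    using ring.genideal_self[OF ring_ring_of_type_algebra, of "clifford_relations sV g"] assms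
    by (auto simp: ring_of_type_algebra_def)
  then show ?thesis
    unfolding clifford_class_def clifford_algebra_def
    by (subst ring.a_rcos_zero[OF ring_ring_of_type_algebra ideal_clifford_ideal])
      (simp_all add: FactRing_def)
qed

lemma clifford_vec_closed: "clifford_vec sV g v \<in> carrier (clifford_algebra sV g)"
  by (simp add: clifford_vec_def clifford_class_closed)

lemma clifford_scale_closed:
  "c \<in> carrier (clifford_algebra sV g) \<Longrightarrow> clifford_scale sV g a c \<in> carrier (clifford_algebra sV g)"
proof -
  interpret C: ring "clifford_algebra sV g" by (rule ring_clifford_algebra)
  show "c \<in> carrier (clifford_algebra sV g) \<Longrightarrow> ?thesis"
    by (simp add: clifford_scale_def clifford_class_closed)
qed

section \<open>The spinor representation\<close>

locale spinor_representation =
  V: nondegenerate_symmetric_space sV BasisV g +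
  S: finite_dimensional_vector_space sS BasisS
  for sV :: "'k::field \<Rightarrow> 'v::ab_group_add \<Rightarrow> 'v" and BasisV g
    and sS :: "'k \<Rightarrow> 's::ab_group_add \<Rightarrow> 's" and BasisS +
  fixes \<rho> :: "('v, 'k) free_alg set \<Rightarrow> 's \<Rightarrow> 's" and B :: "'s \<Rightarrow> 's \<Rightarrow> 'k"
  assumes iso: "clifford_End_iso sV g sS \<rho>"
    and norm: "spinor_norm sV g sS \<rho> B"
begin

abbreviation "C \<equiv> clifford_algebra sV g"

sublocale C: ring C by (rule ring_clifford_algebra)

lemma rho_iso: "\<rho> \<in> ring_iso C (End_ring sS)"
  using iso by (simp add: clifford_End_iso_def)

lemma rho_linear: "c \<in> carrier C \<Longrightarrow> Vector_Spaces.linear sS sS (\<rho> c)"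
  using ring_iso_memE(1)[OF rho_iso, of c] by (simp add: End_ring_def)

lemma rho_mult: "c \<in> carrier C \<Longrightarrow> d \<in> carrier C \<Longrightarrow> \<rho> (c \<otimes>\<^bsub>C\<^esub> d) \<chi> = \<rho> c (\<rho> d \<chi>)"
  using ring_iso_memE(2)[OF rho_iso, of c d] by (simp add: End_ring_def)

lemma rho_add: "c \<in> carrier C \<Longrightarrow> d \<in> carrier C \<Longrightarrow> \<rho> (c \<oplus>\<^bsub>C\<^esub> d) \<chi> = \<rho> c \<chi> + \<rho> d \<chi>"
  using ring_iso_memE(3)[OF rho_iso, of c d] by (simp add: End_ring_def)

lemma rho_one: "\<rho> \<one>\<^bsub>C\<^esub> \<chi> = \<chi>"
  using ring_iso_memE(4)[OF rho_iso] by (simp add: End_ring_def)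

lemma rho_eqI:
  assumes "c \<in> carrier C" "d \<in> carrier C" "\<And>\<chi>. \<rho> c \<chi> = \<rho> d \<chi>"
  shows "c = d"
proof (rule inj_onD)
  show "inj_on \<rho> (carrier C)" using ring_iso_memE(5)[OF rho_iso] by (simp add: bij_betw_def)
  show "\<rho> c = \<rho> d" using assms(3) by (rule ext)
qed (rule assms)+

lemma rho_scale: "c \<in> carrier C \<Longrightarrow> \<rho> (clifford_scale sV g a c) \<chi> = sS a (\<rho> c \<chi>)"
  using iso by (simp add: clifford_End_iso_def)

lemma rho_zero: "\<rho> \<zero>\<^bsub>C\<^esub> \<chi> = 0"
  using rho_add[OF C.zero_closed C.zero_closed, of \<chi>] by simp

lemma rho_diff:
  assumes "c \<in> carrier C" "d \<in> carrier C"
  shows "\<rho> (c \<ominus>\<^bsub>C\<^esub> d) \<chi> = \<rho> c \<chi> - \<rho> d \<chi>"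
proof -
  have "(c \<ominus>\<^bsub>C\<^esub> d) \<oplus>\<^bsub>C\<^esub> d = c"
    using assms by (simp add: C.minus_eq C.a_assoc C.l_neg)
  then have "\<rho> (c \<ominus>\<^bsub>C\<^esub> d) \<chi> + \<rho> d \<chi> = \<rho> c \<chi>"
    using rho_add[of "c \<ominus>\<^bsub>C\<^esub> d" d \<chi>] assms by simp
  then show ?thesis by (simp add: eq_diff_eq)
qed

lemma rho_finsum:
  assumes "finite A" "\<And>p. p \<in> A \<Longrightarrow> f p \<in> carrier C"
  shows "\<rho> (\<Oplus>\<^bsub>C\<^esub>p\<in>A. f p) \<chi> = (\<Sum>p\<in>A. \<rho> (f p) \<chi>)"
  using assms
proof (induction A)
  case empty
  then show ?case by (simp add: rho_zero)
next
  case (insert q A)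
  then have f: "f \<in> A \<rightarrow> carrier C" "f q \<in> carrier C" by auto
  then have "\<rho> (\<Oplus>\<^bsub>C\<^esub>p\<in>insert q A. f p) \<chi> = \<rho> (f q) \<chi> + \<rho> (\<Oplus>\<^bsub>C\<^esub>p\<in>A. f p) \<chi>"
    using insert by (simp add: C.finsum_insert rho_add)
  then show ?case using insert by simp
qed

text \<open>The action pulled back to the free algebra, where the defining relations of the Clifford algebra
  are elements that act as zero.\<close>

definition rep :: "('v, 'k) free_alg \<Rightarrow> 's \<Rightarrow> 's" where
  "rep t = \<rho> (clifford_class sV g t)"

lemma rep_add: "rep (s + t) \<chi> = rep s \<chi> + rep t \<chi>"
  by (simp add: rep_def clifford_class_add clifford_class_closed rho_add)

lemma rep_diff: "rep (s - t) \<chi> = rep s \<chi> - rep t \<chi>"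
  using rep_add[of "s - t" t \<chi>] by (simp add: eq_diff_eq)

lemma rep_mult: "rep (s * t) \<chi> = rep s (rep t \<chi>)"
  by (simp add: rep_def clifford_class_mult clifford_class_closed rho_mult)

lemma rep_const: "rep (free_const a) \<chi> = sS a \<chi>"
  using rho_scale[OF C.one_closed, of a \<chi>]
  by (simp add: rep_def clifford_scale_def clifford_class_closed rho_one)

lemma rep_relation: "r \<in> clifford_relations sV g \<Longrightarrow> rep r \<chi> = 0"
  by (simp add: rep_def clifford_class_relation rho_zero)

abbreviation act :: "'v \<Rightarrow> 's \<Rightarrow> 's" where
  "act v \<equiv> \<rho> (clifford_vec sV g v)"

sublocale clifford_module_form sV BasisV g sS BasisS act B
proof
  fix v w :: 'v and a :: 'k and \<chi> \<psi> \<phi> :: 's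
  have act: "act u \<eta> = rep (free_gen u) \<eta>" for u \<eta>
    by (simp add: rep_def clifford_vec_def)
  have "rep (free_gen (v + w) - free_gen v - free_gen w) \<chi> = 0"
    by (rule rep_relation) (auto simp: clifford_relations_def)
  then show "act (v + w) \<chi> = act v \<chi> + act w \<chi>"
    by (simp add: act rep_add rep_diff diff_diff_eq)
  have "rep (free_gen (sV a v) - free_const a * free_gen v) \<chi> = 0"
    by (rule rep_relation) (auto simp: clifford_relations_def)
  then show "act (sV a v) \<chi> = sS a (act v \<chi>)"
    by (simp add: act rep_diff rep_mult rep_const)
  have "rep (free_gen v * free_gen w + free_gen w * free_gen v - free_const (2 * g v w)) \<chi> = 0"
    by (rule rep_relation) (auto simp: clifford_relations_def)
  then show "act v (act w \<chi>) + act w (act v \<chi>) = sS (2 * g v w) \<chi>"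
    by (simp add: act rep_diff rep_add rep_mult rep_const)
  interpret l: Vector_Spaces.linear sS sS "act v" by (intro rho_linear clifford_vec_closed)
  show "act v (\<chi> + \<psi>) = act v \<chi> + act v \<psi>" "act v (sS a \<chi>) = sS a (act v \<chi>)"
    by (simp_all add: l.add l.scale)
  show "bilinear_form sS B" "B (act v \<phi>) \<psi> = B \<phi> (act v \<psi>)"
    using norm by (simp_all add: spinor_norm_def)
qed

text \<open>The definite description picks out the value in \<open>x\<close> because all orthonormal bases give the same
  vector and \<open>x\<close> shows that there is at least one.\<close>

lemma spinor_dual_eq:
  assumes x: "orthonormal_basis sV g (2 * n) x"
  shows "spinor_dual sV g \<rho> B n \<phi> \<psi> = dual (2 * n) x \<phi> \<psi>"
proof -
  have "spinor_dual_wrt sV g \<rho> B n y \<phi> \<psi> = dual (2 * n) y \<phi> \<psi>" for y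
    by (simp add: spinor_dual_wrt_def dual_def)
  then show ?thesis
    unfolding spinor_dual_def
    using x dual_basis_independent[OF x] by (intro the_equality) metis+
qed

lemma bivector_summand_closed:
  "(case p of (i, j) \<Rightarrow> clifford_scale sV g (a i j)
     (clifford_vec sV g (x i) \<otimes>\<^bsub>C\<^esub> clifford_vec sV g (x j))) \<in> carrier C"
  by (cases p) (simp add: clifford_scale_closed clifford_vec_closed)

lemma tilde_L2_wrt_closed: "tilde_L2_wrt sV g \<rho> B n x \<phi> \<psi> \<in> carrier C"
  unfolding tilde_L2_wrt_def Let_def
  by (rule clifford_scale_closed, rule C.finsum_closed, rule Pi_I, rule bivector_summand_closed)

lemma rho_tilde_L2_wrt: "\<rho> (tilde_L2_wrt sV g \<rho> B n x \<phi> \<psi>) \<chi> = bivector (2 * n) x \<phi> \<psi> \<chi>"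
proof -
  let ?P = "{(i, j). 1 \<le> i \<and> i < j \<and> j \<le> 2 * n}"
  let ?e = "\<lambda>i. clifford_vec sV g (x i)"
  let ?f = "\<lambda>p. case p of (i, j) \<Rightarrow> clifford_scale sV g
    (g (x i) (x i) * g (x j) (x j) * B \<phi> (\<rho> (?e j \<otimes>\<^bsub>C\<^esub> ?e i) \<psi>)) (?e i \<otimes>\<^bsub>C\<^esub> ?e j)"
  have f: "?f p \<in> carrier C" for p
    by (rule bivector_summand_closed)
  have "?P \<subseteq> {1..2 * n} \<times> {1..2 * n}" by auto
  then have fin: "finite ?P" by (rule finite_subset) simp
  have "\<rho> (tilde_L2_wrt sV g \<rho> B n x \<phi> \<psi>) \<chi> = sS (1 / 2) (\<rho> (\<Oplus>\<^bsub>C\<^esub>p\<in>?P. ?f p) \<chi>)"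
    unfolding tilde_L2_wrt_def Let_def
    by (rule rho_scale, rule C.finsum_closed, rule Pi_I, rule f)
  also have "\<rho> (\<Oplus>\<^bsub>C\<^esub>p\<in>?P. ?f p) \<chi> = (\<Sum>p\<in>?P. \<rho> (?f p) \<chi>)"
    using fin f by (rule rho_finsum)
  also have "sS (1 / 2) \<dots> = bivector (2 * n) x \<phi> \<psi> \<chi>"
    unfolding bivector_def
    by (intro arg_cong[of _ _ "sS (1 / 2)"] sum.cong)
      (auto simp: rho_scale rho_mult clifford_vec_closed)
  finally show ?thesis .
qed

text \<open>Elements of the Clifford algebra computed in different bases agree because they act on spinors by
  the same operator and \<open>\<rho>\<close> is injective.\<close>

lemma tilde_L2_eq:
  assumes x: "orthonormal_basis sV g (2 * n) x"
  shows "tilde_L2 sV g \<rho> B n \<phi> \<psi> = tilde_L2_wrt sV g \<rho> B n x \<phi> \<psi>"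
proof -
  have "tilde_L2_wrt sV g \<rho> B n x \<phi> \<psi> = tilde_L2_wrt sV g \<rho> B n y \<phi> \<psi>"
    if "orthonormal_basis sV g (2 * n) y" for y
    by (rule rho_eqI)
      (simp_all add: tilde_L2_wrt_closed rho_tilde_L2_wrt bivector_basis_independent[OF x that])
  then show ?thesis
    unfolding tilde_L2_def using x by (intro the_equality) blast+
qed

end

theorem proposition3p5:
  fixes sV :: "'k::field \<Rightarrow> 'v::ab_group_add \<Rightarrow> 'v"
    and sS :: "'k \<Rightarrow> 's::ab_group_add \<Rightarrow> 's"
    and g :: "'v \<Rightarrow> 'v \<Rightarrow> 'k"
    and \<rho> :: "('v, 'k) free_alg set \<Rightarrow> 's \<Rightarrow> 's"
    and B :: "'s \<Rightarrow> 's \<Rightarrow> 'k"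
    and n :: nat
  assumes "CHAR('k) \<noteq> 2" and "CHAR('k) \<noteq> 3"
    and "has_dimension sV (2 * n)"
    and "bilinear_form sV g" and "symmetric_form g" and "nondegenerate g"
    and "witt_index sV g = n"
    and "has_dimension sS (2 ^ n)"
    and "clifford_End_iso sV g sS \<rho>"
    and "spinor_norm sV g sS \<rho> B" and "nondegenerate B"
  shows
    "(\<forall>\<phi> \<psi> v.
        clifford_scale sV g 2
          (commutator (clifford_algebra sV g) (tilde_L2 sV g \<rho> B n \<phi> \<psi>) (clifford_vec sV g v))
        = clifford_vec sV g
            (sV ((- 1) ^ (n * (n - 1) div 2)) (spinor_dual sV g \<rho> B n \<psi> (spinor_map sV g \<rho> \<phi> v))
             - spinor_dual sV g \<rho> B n \<phi> (spinor_map sV g \<rho> \<psi> v))) \<and>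
     (\<forall>\<phi> \<psi> v.
        sV (2 * B \<phi> \<psi>) v
        = sV ((- 1) ^ (n * (n - 1) div 2)) (spinor_dual sV g \<rho> B n \<psi> (spinor_map sV g \<rho> \<phi> v))
          + spinor_dual sV g \<rho> B n \<phi> (spinor_map sV g \<rho> \<psi> v))"
proof -
  obtain BasisV where V: "finite_dimensional_vector_space sV BasisV" "card BasisV = 2 * n"
    using assms(3) by (auto simp: has_dimension_def)
  obtain BasisS where S: "finite_dimensional_vector_space sS BasisS" "card BasisS = 2 ^ n"
    using assms(8) by (auto simp: has_dimension_def)
  have "\<not> CHAR('k) dvd 2"
  proof
    assume dvd: "CHAR('k) dvd 2"
    then have "CHAR('k) \<le> 2" by (rule dvd_imp_le) simp
    then have "CHAR('k) = 0" using assms(1) CHAR_not_1'[where 'a = 'k] by linarith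
    then show False using dvd by simp
  qed
  then have "(of_nat 2 :: 'k) \<noteq> 0" unfolding of_nat_eq_0_iff_char_dvd .
  then have two: "(2::'k) \<noteq> 0" by simp
  interpret V: finite_dimensional_vector_space sV BasisV by (rule V(1))
  interpret S: finite_dimensional_vector_space sS BasisS by (rule S(1))
  interpret spinor_representation sV BasisV g sS BasisS \<rho> B
    by unfold_locales (use assms two in auto)
  obtain w w' where h: "V.hyperbolic_pairs n w w'"
    using V.witt_index_attained V.hyperbolic_pairs_exist assms(7) by metis
  obtain x where x: "orthonormal_basis sV g (2 * n) x"
    using V.orthonormal_basis_exists[OF h V(2)] by blast
  define \<epsilon> :: 'k where "\<epsilon> = (- 1) ^ (n * (n - 1) div 2)"
  have sym: "B \<psi> \<phi> = \<epsilon> * B \<phi> \<psi>" for \<phi> \<psi>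
    unfolding \<epsilon>_def by (rule B_symmetry[OF h S(2)])
  let ?L = "tilde_L2 sV g \<rho> B n" and ?D = "spinor_dual sV g \<rho> B n" and ?e = "clifford_vec sV g"
  have L: "?L \<phi> \<psi> \<in> carrier C" for \<phi> \<psi>
    by (simp add: tilde_L2_eq[OF x] tilde_L2_wrt_closed)
  have comm: "commutator C (?L \<phi> \<psi>) (?e v) \<in> carrier C" for \<phi> \<psi> v
    using L by (simp add: commutator_def clifford_vec_closed)
  have "clifford_scale sV g 2 (commutator C (?L \<phi> \<psi>) (?e v))
      = ?e (sV \<epsilon> (?D \<psi> (act v \<phi>)) - ?D \<phi> (act v \<psi>))" for \<phi> \<psi> v
  proof (rule rho_eqI)
    fix \<chi>
    have "\<rho> (clifford_scale sV g 2 (commutator C (?L \<phi> \<psi>) (?e v))) \<chi>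
        = sS 2 (bivector (2 * n) x \<phi> \<psi> (act v \<chi>) - act v (bivector (2 * n) x \<phi> \<psi> \<chi>))"
      unfolding rho_scale[OF comm] unfolding commutator_def tilde_L2_eq[OF x]
      by (simp add: rho_diff rho_mult tilde_L2_wrt_closed clifford_vec_closed rho_tilde_L2_wrt)
    then show "\<rho> (clifford_scale sV g 2 (commutator C (?L \<phi> \<psi>) (?e v))) \<chi>
        = act (sV \<epsilon> (?D \<psi> (act v \<phi>)) - ?D \<phi> (act v \<psi>)) \<chi>"
      unfolding bivector_commutator[OF x sym] spinor_dual_eq[OF x] .
  qed (simp_all add: clifford_scale_closed comm clifford_vec_closed)
  moreover have "sV (2 * B \<phi> \<psi>) v = sV \<epsilon> (?D \<psi> (act v \<phi>)) + ?D \<phi> (act v \<psi>)" for \<phi> \<psi> v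
    unfolding spinor_dual_eq[OF x] by (rule dual_sum[OF x sym])
  ultimately show ?thesis
    unfolding \<epsilon>_def spinor_map_def by blast
qed

end
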